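(* Let $n\ge 1$ and let $G=P_{k_0}\Box P_{k_1}\Box\cdots\Box P_{k_{n-1}}$ (with integers $k_i\ge 2$) be an $n$-grid graph, and let $n(G)=|V(G)|$ be its order. If $n(G)$ is even, then $mp(G)=n$, and $G$ is super matched whenever $n\ge 3$. If $n(G)$ is odd, then $mp(G)=n+1$; moreover, if $n\ge 2$ (and $n(G)$ is odd), then a set $F\subseteq E(G)$ is an optimal matching preclusion set of $G$ if and only if $F$ consists of the edges incident with a vertex $u=(u_0,u_1,\ldots,u_{n-1})$ (that is, $F$ is the set of all edges of $G$ incident with $u$) such that $d_G(u)=n+1$ and $\sum_{i=0}^{n-1}u_i$ is odd.
   Context: $P_k$ denotes the path with $k$ vertices, with vertex set $\{0,1,\ldots,k-1\}$ and edges $j(j+1)$ for $0\le j\le k-2$. For integers $n\ge 1$ and $k_0,\ldots,k_{n-1}\ge 2$, the $n$-grid graph $G=P_{k_0}\Box\cdots\Box P_{k_{n-1}}$ is the Cartesian product of these paths: its vertices are the $n$-tuples $(u_0,\ldots,u_{n-1})$ with $0\le u_i\le k_i-1$, and two vertices are adjacent iff they differ in exactly one coordinate, and in that coordinate they differ by $1$. $d_G(u)$ is the degree of $u$ in $G$. A perfect matching of a graph is a matching covering all vertices; an almost perfect matching is a matching covering all but exactly one vertex. A matching preclusion set of $G$ is a set $F\subseteq E(G)$ such that $G-F$ (deletion of the edges in $F$) has neither a perfect matching nor an almost perfect matching. A matching preclusion set of minimum cardinality is called optimal, and its cardinality is the matching preclusion number $mp(G)$. For a graph of even order, a matching preclusion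 set $F$ is trivial if the edges of $F$ are those edges incident with a single vertex (i.e. there is a vertex $v$ such that $F$ is the set of all edges incident with $v$). A graph of even order is super matched if every optimal matching preclusion set of it is trivial. *)

theory Defs
  imports "HOL-Library.FuncSet" "HOL-Library.Disjoint_Sets"
begin

record 'a graph =
  verts :: "'a set"
  edges :: "'a set set"

definition incident_edges :: "'a graph \<Rightarrow> 'a \<Rightarrow> 'a set set" where
  "incident_edges G v = {e \<in> edges G. v \<in> e}"

definition degree :: "'a graph \<Rightarrow> 'a \<Rightarrow> nat" where
  "degree G v = card (incident_edges G v)"

definition delete_edges :: "'a graph \<Rightarrow> 'a set set \<Rightarrow> 'a graph" where
  "delete_edges G F = G\<lparr>edges := edges G - F\<rparr>"

definition matching :: "'a graph \<Rightarrow> 'a set set \<Rightarrow> bool" where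
  "matching G M \<longleftrightarrow> M \<subseteq> edges G \<and> disjoint M"

definition perfect_matching :: "'a graph \<Rightarrow> 'a set set \<Rightarrow> bool" where
  "perfect_matching G M \<longleftrightarrow> matching G M \<and> \<Union>M = verts G"

definition almost_perfect_matching :: "'a graph \<Rightarrow> 'a set set \<Rightarrow> bool" where
  "almost_perfect_matching G M \<longleftrightarrow> matching G M \<and> (\<exists>v\<in>verts G. \<Union>M = verts G - {v})"

definition matching_preclusion_set :: "'a graph \<Rightarrow> 'a set set \<Rightarrow> bool" where
  "matching_preclusion_set G F \<longleftrightarrow> F \<subseteq> edges G \<and>
     \<not> (\<exists>M. perfect_matching (delete_edges G F) M) \<and>
     \<not> (\<exists>M. almost_perfect_matching (delete_edges G F) M)"

(* Cardinalities are compared with card, so the next definitions are meant for finite graphs. *)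

definition optimal_matching_preclusion_set :: "'a graph \<Rightarrow> 'a set set \<Rightarrow> bool" where
  "optimal_matching_preclusion_set G F \<longleftrightarrow> matching_preclusion_set G F \<and>
     (\<forall>F'. matching_preclusion_set G F' \<longrightarrow> card F \<le> card F')"

definition mp :: "'a graph \<Rightarrow> nat" where
  "mp G = (LEAST m. \<exists>F. matching_preclusion_set G F \<and> card F = m)"

definition super_matched :: "'a graph \<Rightarrow> bool" where
  "super_matched G \<longleftrightarrow> even (card (verts G)) \<and>
     (\<forall>F. optimal_matching_preclusion_set G F \<longrightarrow> (\<exists>v\<in>verts G. F = incident_edges G v))"

(* An n-tuple (u_0, ..., u_{n-1}) is an extensional function on {..<n}, i.e. one that
   is undefined outside {..<n}, so that distinct functions are distinct tuples. *)

definition grid_adj :: "nat \<Rightarrow> (nat \<Rightarrow> nat) \<Rightarrow> (nat \<Rightarrow> nat) \<Rightarrow> bool" where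
  "grid_adj n u v \<longleftrightarrow>
     (\<exists>i<n. (u i = v i + 1 \<or> v i = u i + 1) \<and> (\<forall>j<n. j \<noteq> i \<longrightarrow> u j = v j))"

definition grid :: "nat \<Rightarrow> (nat \<Rightarrow> nat) \<Rightarrow> (nat \<Rightarrow> nat) graph" where
  "grid n k =
     (let V = (\<Pi>\<^sub>E i\<in>{..<n}. {..<k i})
      in \<lparr>verts = V, edges = {{u, v} | u v. u \<in> V \<and> v \<in> V \<and> grid_adj n u v}\<rparr>)"

end

(* Split the grid by the parity of the coordinate sum into odd and even vertices. There are as many
   odd as even vertices if the order is even, and one even vertex more if it is odd. So, by Hall's
   theorem on the odd side, F is a preclusion set only if there are a set S of odd vertices and a
   set T of even vertices with |S| > |T| such that F contains every edge from S to an even vertex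
   outside T. Put X = S + T and let e_i be the number of such "bad" edges in direction i.

   Compare S and T on every line in direction i. On a line of even length |S| - |T| is at most
   the number of bad edges. On a line of odd length with even ends one can subtract 1 if the line
   meets X, and with odd ends one has to add 1 if the line lies in X. Summing over the lines,
   |S| - |T| <= e_i if k_i is even, and |S| - |T| <= e_i + |S'| - |T'| if k_i is odd, where S' is
   the set of odd lines contained in X and T' the set of even lines meeting X, inside the grid with
   one dimension less. Each bad edge of (S', T') lies below at least two bad edges of (S, T), so if
   e_i = 0 for some i, induction already gives enough bad edges. Otherwise all e_i are
   positive, and tightness of the line inequalities determines the extremal sets X. *)

theory Submission
  imports Defs
begin

section \<open>Paths\<close>

text \<open>Position x of a path in a box has the parity of p + x, where p is the sum of the fixed
  coordinates. The set Y is the trace on the path of the vertex set X from the header.\<close>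

definition bad1 :: "nat \<Rightarrow> nat \<Rightarrow> nat set \<Rightarrow> (nat \<times> nat) set" where
  "bad1 m p Y = {(x, y). x < m \<and> y < m \<and> x \<in> Y \<and> y \<notin> Y \<and> odd (p + x) \<and> (x = y + 1 \<or> y = x + 1)}"

text \<open>Odd vertices count positively because Hall's condition is tested on the odd side; a
  violation then shows as positive excess.\<close>

definition psign :: "nat \<Rightarrow> int" where
  "psign s = (if odd s then 1 else - 1)"

definition exc1 :: "nat \<Rightarrow> nat \<Rightarrow> nat set \<Rightarrow> int" where
  "exc1 m p Y = (\<Sum>x<m. if x \<in> Y then psign (p + x) else 0)"

text \<open>The left ends stand for the maximal segments of \<open>Y\<close> within the path, so the
  cardinality is the number of segments.\<close>

definition starts :: "nat \<Rightarrow> nat set \<Rightarrow> nat set" where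
  "starts m Y = {x \<in> Y. x < m \<and> (x = 0 \<or> x - 1 \<notin> Y)}"

lemma finite_bad1 [simp]: "finite (bad1 m p Y)"
  by (rule finite_subset[of _ "{..<m} \<times> {..<m}"]) (auto simp: bad1_def)

lemma finite_starts [simp]: "finite (starts m Y)"
  by (simp add: starts_def)

lemma bad1_Suc_Suc:
  "bad1 (Suc (Suc m)) p Y = bad1 (Suc m) p Y \<union>
     (if m \<in> Y \<and> Suc m \<notin> Y \<and> odd (p + m) then {(m, Suc m)}
      else if Suc m \<in> Y \<and> m \<notin> Y \<and> odd (p + Suc m) then {(Suc m, m)} else {})"
  unfolding bad1_def by (auto simp: less_Suc_eq)

lemma card_bad1_Suc_Suc:
  "card (bad1 (Suc (Suc m)) p Y) = card (bad1 (Suc m) p Y) +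
     (if m \<in> Y \<and> Suc m \<notin> Y \<and> odd (p + m) \<or> Suc m \<in> Y \<and> m \<notin> Y \<and> odd (p + Suc m) then 1 else 0)"
proof -
  have "(m, Suc m) \<notin> bad1 (Suc m) p Y" "(Suc m, m) \<notin> bad1 (Suc m) p Y"
    by (auto simp: bad1_def)
  then show ?thesis by (subst bad1_Suc_Suc) auto
qed

lemma starts_Suc:
  "starts (Suc m) Y = starts m Y \<union> (if m \<in> Y \<and> (m = 0 \<or> m - 1 \<notin> Y) then {m} else {})"
  by (auto simp: starts_def less_Suc_eq)

lemma card_starts_Suc:
  "card (starts (Suc m) Y) = card (starts m Y) + (if m \<in> Y \<and> (m = 0 \<or> m - 1 \<notin> Y) then 1 else 0)"
proof -
  have "m \<notin> starts m Y" by (auto simp: starts_def)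
  then show ?thesis by (subst starts_Suc) auto
qed

text \<open>A maximal segment of Y contributes its number of odd ends minus 1 to the excess; an odd end
  gives a bad edge unless it is an end of the path.\<close>

lemma exc1_eq:
  "exc1 (Suc m) p Y = int (card (bad1 (Suc m) p Y)) + of_bool (0 \<in> Y \<and> odd p)
     + of_bool (m \<in> Y \<and> odd (p + m)) - int (card (starts (Suc m) Y))"
proof (induction m)
  case 0
  have "bad1 (Suc 0) p Y = {}" by (auto simp: bad1_def)
  moreover have "starts (Suc 0) Y = (if 0 \<in> Y then {0} else {})" by (auto simp: starts_def)
  ultimately show ?case by (auto simp: exc1_def psign_def)
next
  case (Suc m)
  have "exc1 (Suc (Suc m)) p Y = exc1 (Suc m) p Y + (if Suc m \<in> Y then psign (p + Suc m) else 0)"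
    by (simp add: exc1_def)
  then show ?case
    unfolding Suc.IH card_bad1_Suc_Suc card_starts_Suc[of "Suc m"] by (auto simp: psign_def)
qed

lemma starts_ge1:
  assumes "y \<in> Y" "y < m" shows "card (starts m Y) \<ge> 1"
proof -
  let ?x = "LEAST x. x \<in> Y"
  have "?x \<in> Y" "?x \<le> y" using assms(1) by (auto intro: LeastI Least_le)
  moreover have "?x - 1 \<notin> Y" if "?x \<noteq> 0" using not_less_Least[of "?x - 1" "\<lambda>x. x \<in> Y"] that by auto
  ultimately have "?x \<in> starts m Y" using assms by (auto simp: starts_def)
  then show ?thesis by (metis card_gt_0_iff finite_starts empty_iff One_nat_def Suc_leI)
qed

text \<open>A gap \<open>g\<close> separates the segment of \<open>0\<close> from that of
  \<open>m - 1\<close>; the least member of \<open>Y\<close> beyond \<open>g\<close> starts a second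
  segment.\<close>

lemma starts_ge2:
  assumes "0 \<in> Y" "m - 1 \<in> Y" "g < m" "g \<notin> Y" shows "card (starts m Y) \<ge> 2"
proof -
  let ?P = "\<lambda>x. x \<in> Y \<and> g < x"
  let ?x = "LEAST x. ?P x"
  have P: "?P (m - 1)" using assms by (cases "g = m - 1") auto
  then have x: "?P ?x" "?x \<le> m - 1" by (rule LeastI, rule Least_le)
  have "?x - 1 \<notin> Y"
  proof (cases "?x - 1 = g")
    case False
    then show ?thesis using not_less_Least[of "?x - 1" ?P] x by auto
  qed (use assms in auto)
  then have "{0, ?x} \<subseteq> starts m Y" using assms x by (auto simp: starts_def)
  moreover have "?x \<noteq> 0" using x by simp
  ultimately show ?thesis using card_mono[of "starts m Y" "{0, ?x}"] by simp
qed

section \<open>Excess of a set on one path, bounded by its bad edges\<close>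

lemma exc1_odd_even:
  assumes "odd m" "even p"
  shows "exc1 m p Y \<le> int (card (bad1 m p Y)) - of_bool (Y \<inter> {..<m} \<noteq> {})"
proof -
  obtain l where "m = Suc l" using assms(1) by (cases m) auto
  then show ?thesis using exc1_eq[of l p Y] starts_ge1[of _ Y m] assms by fastforce
qed

text \<open>Both ends of the path are odd, and each may add 1 in \<open>exc1_eq\<close>. Occupying
  both costs one segment if the path is filled and at least two otherwise, so only a full path
  gains.\<close>

lemma exc1_odd_odd:
  assumes "odd m" "odd p"
  shows "exc1 m p Y \<le> int (card (bad1 m p Y)) + of_bool ({..<m} \<subseteq> Y)"
proof -
  obtain l where l: "m = Suc l" using assms(1) by (cases m) auto
  have eq: "exc1 m p Y = int (card (bad1 m p Y)) + of_bool (0 \<in> Y)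
     + of_bool (l \<in> Y) - int (card (starts m Y))" using exc1_eq[of l p Y] assms l by auto
  show ?thesis
  proof (cases "Y \<inter> {..<m} = {}")
    case True
    then have "0 \<notin> Y" "l \<notin> Y" using l by auto
    then show ?thesis using eq by auto
  next
    case ne: False
    then have 1: "card (starts m Y) \<ge> 1" using starts_ge1 by blast
    show ?thesis
    proof (cases "0 \<in> Y \<and> l \<in> Y \<and> \<not> {..<m} \<subseteq> Y")
      case True
      then have "card (starts m Y) \<ge> 2" using starts_ge2[of Y m] l by auto
      then show ?thesis using eq by auto
    next
      case False
      then show ?thesis using eq 1 by (auto split: if_splits)
    qed
  qed
qed

text \<open>A nonempty path of even length has exactly one odd end. Equality leaves only the empty
  set and a single segment beginning at the odd end, which reaches the even end only if it fills the
  path.\<close>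

lemma exc1_even:
  assumes "even m"
  shows "exc1 m p Y \<le> int (card (bad1 m p Y))"
    and "exc1 m p Y = int (card (bad1 m p Y)) \<Longrightarrow> Y \<inter> {..<m} \<noteq> {} \<Longrightarrow> (if odd p then 0 else m - 1) \<in> Y"
    and "exc1 m p Y = int (card (bad1 m p Y)) \<Longrightarrow> \<not> {..<m} \<subseteq> Y \<Longrightarrow> (if odd p then m - 1 else 0) \<notin> Y"
proof -
  consider "m = 0" | l where "m = Suc l" by (cases m) auto
  then have "exc1 m p Y \<le> int (card (bad1 m p Y)) \<and> (exc1 m p Y = int (card (bad1 m p Y)) \<longrightarrow>
     (Y \<inter> {..<m} \<noteq> {} \<longrightarrow> (if odd p then 0 else m - 1) \<in> Y) \<and>
     (\<not> {..<m} \<subseteq> Y \<longrightarrow> (if odd p then m - 1 else 0) \<notin> Y))"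
  proof cases
    case 1
    then show ?thesis by (simp add: exc1_def)
  next
    case 2
    \<comment> \<open>\<open>?b\<close> is the odd end of the path and \<open>?a\<close> the even
      end.\<close>
    let ?b = "if odd p then 0 else m - 1"
    let ?a = "if odd p then m - 1 else 0"
    have ab: "?a < m" "?b < m" using 2 by auto
    have eq: "exc1 m p Y = int (card (bad1 m p Y)) + of_bool (?b \<in> Y) - int (card (starts m Y))"
      using exc1_eq[of l p Y] assms 2 by auto
    have 1: "?b \<in> Y \<Longrightarrow> card (starts m Y) \<ge> 1" using starts_ge1 ab by blast
    have 3: "Y \<inter> {..<m} \<noteq> {} \<Longrightarrow> card (starts m Y) \<ge> 1" using starts_ge1 by blast
    have 4: "card (starts m Y) \<ge> 2" if "?a \<in> Y" "?b \<in> Y" "\<not> {..<m} \<subseteq> Y"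
      using starts_ge2[of Y m] that 2 by (auto split: if_splits)
    have i: "exc1 m p Y \<le> int (card (bad1 m p Y))" using eq 1 by (cases "?b \<in> Y") auto
    have ii: "?b \<in> Y" if "exc1 m p Y = int (card (bad1 m p Y))" "Y \<inter> {..<m} \<noteq> {}"
      using eq 3 that by (cases "?b \<in> Y") auto
    have iii: "?a \<notin> Y" if "exc1 m p Y = int (card (bad1 m p Y))" "\<not> {..<m} \<subseteq> Y"
    proof
      assume a: "?a \<in> Y"
      then have "?b \<in> Y" using ii that ab by blast
      then have "card (starts m Y) \<ge> 2" "of_bool (?b \<in> Y) = (1::int)" using 4 a that by auto
      then show False using eq that by linarith
    qed
    show ?thesis using i ii iii by blast
  qed
  then show "exc1 m p Y \<le> int (card (bad1 m p Y))"
    and "exc1 m p Y = int (card (bad1 m p Y)) \<Longrightarrow> Y \<inter> {..<m} \<noteq> {} \<Longrightarrow> (if odd p then 0 else m - 1) \<in> Y"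
    and "exc1 m p Y = int (card (bad1 m p Y)) \<Longrightarrow> \<not> {..<m} \<subseteq> Y \<Longrightarrow> (if odd p then m - 1 else 0) \<notin> Y"
    by blast+
qed

section \<open>Boxes and their lines\<close>

text \<open>The index set is arbitrary, so that inductions can delete a direction.\<close>

definition box :: "'i set \<Rightarrow> ('i \<Rightarrow> nat) \<Rightarrow> ('i \<Rightarrow> nat) set" where
  "box I k = (\<Pi>\<^sub>E i\<in>I. {..<k i})"

text \<open>Agreement is required at every index other than \<open>i\<close>; within a box this adds
  nothing, since its members are \<open>undefined\<close> off the index set.\<close>

definition step :: "'i \<Rightarrow> ('i \<Rightarrow> nat) \<Rightarrow> ('i \<Rightarrow> nat) \<Rightarrow> bool" where
  "step i u v \<longleftrightarrow> (u i = v i + 1 \<or> v i = u i + 1) \<and> (\<forall>j. j \<noteq> i \<longrightarrow> u j = v j)"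

text \<open>Ordered pairs directed out of \<open>X\<close>: each boundary edge occurs once, with its
  end in \<open>X\<close> first.\<close>

definition bnd :: "'i set \<Rightarrow> ('i \<Rightarrow> nat) \<Rightarrow> ('i \<Rightarrow> nat) set \<Rightarrow> 'i \<Rightarrow> (('i \<Rightarrow> nat) \<times> ('i \<Rightarrow> nat)) set" where
  "bnd I k X i = {(u, v). u \<in> box I k \<and> v \<in> box I k \<and> u \<in> X \<and> v \<notin> X \<and> step i u v}"

definition bad :: "'i set \<Rightarrow> ('i \<Rightarrow> nat) \<Rightarrow> ('i \<Rightarrow> nat) set \<Rightarrow> 'i \<Rightarrow> (('i \<Rightarrow> nat) \<times> ('i \<Rightarrow> nat)) set" where
  "bad I k X i = {(u, v) \<in> bnd I k X i. odd (sum u I)}"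

text \<open>The quantity |S| - |T| of the header, for finite X.\<close>

definition exc :: "'i set \<Rightarrow> ('i \<Rightarrow> nat) set \<Rightarrow> int" where
  "exc I X = (\<Sum>u\<in>X. psign (sum u I))"

definition line :: "'i \<Rightarrow> ('i \<Rightarrow> nat) \<Rightarrow> ('i \<Rightarrow> nat) set \<Rightarrow> nat set" where
  "line i w X = {x. w(i := x) \<in> X}"

text \<open>The set of lines S' + T' of the header; a line is represented by its other coordinates.\<close>

definition proj :: "'i set \<Rightarrow> ('i \<Rightarrow> nat) \<Rightarrow> 'i \<Rightarrow> ('i \<Rightarrow> nat) set \<Rightarrow> ('i \<Rightarrow> nat) set" where
  "proj I k i X = {w \<in> box (I - {i}) k.
     if odd (sum w (I - {i})) then {..<k i} \<subseteq> line i w X else line i w X \<inter> {..<k i} \<noteq> {}}"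

section \<open>Elementary facts on boxes, steps and coordinate updates\<close>

lemma finite_box [simp]: "finite I \<Longrightarrow> finite (box I k)"
  by (simp add: box_def finite_PiE)

lemma finite_bnd [simp]: "finite I \<Longrightarrow> finite (bnd I k X i)"
  by (rule finite_subset[of _ "box I k \<times> box I k"]) (auto simp: bnd_def)

lemma finite_bad [simp]: "finite I \<Longrightarrow> finite (bad I k X i)"
  by (rule finite_subset[of _ "bnd I k X i"]) (auto simp: bad_def)

lemma mem_bad:
  "(u, v) \<in> bad I k X i \<longleftrightarrow>
     u \<in> box I k \<and> v \<in> box I k \<and> u \<in> X \<and> v \<notin> X \<and> step i u v \<and> odd (sum u I)"
  by (auto simp: bad_def bnd_def)

lemma mem_bnd:
  "(u, v) \<in> bnd I k X i \<longleftrightarrow> u \<in> box I k \<and> v \<in> box I k \<and> u \<in> X \<and> v \<notin> X \<and> step i u v"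
  by (auto simp: bnd_def)

lemma finite_proj [simp]: "finite I \<Longrightarrow> finite (proj I k i X)"
  by (simp add: proj_def)

lemma proj_subset: "proj I k i X \<subseteq> box (I - {i}) k"
  by (auto simp: proj_def)

lemma box_upd: "w \<in> box (I - {i}) k \<Longrightarrow> i \<in> I \<Longrightarrow> x < k i \<Longrightarrow> w(i := x) \<in> box I k"
  by (auto simp: box_def PiE_iff extensional_def)

lemma box_upd_same: "u \<in> box I k \<Longrightarrow> i \<in> I \<Longrightarrow> x < k i \<Longrightarrow> u(i := x) \<in> box I k"
  by (auto simp: box_def PiE_iff extensional_def)

lemma box_drop: "u \<in> box I k \<Longrightarrow> u(i := undefined) \<in> box (I - {i}) k"
  by (auto simp: box_def PiE_iff extensional_def)

lemma box_less: "u \<in> box I k \<Longrightarrow> i \<in> I \<Longrightarrow> u i < k i"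
  by (auto simp: box_def PiE_iff)

lemma box_undefined: "w \<in> box I k \<Longrightarrow> i \<notin> I \<Longrightarrow> w i = undefined"
  by (auto simp: box_def PiE_iff extensional_def)

lemma sum_upd:
  fixes u :: "'i \<Rightarrow> nat"
  assumes "finite I" "i \<in> I" shows "sum (u(i := x)) I = sum u (I - {i}) + x"
proof -
  have "sum (u(i := x)) (I - {i}) = sum u (I - {i})" by (rule sum.cong) auto
  then show ?thesis using sum.remove[OF assms, of "u(i := x)"] by simp
qed

lemma sum_drop: "sum (u(i := x)) (I - {i}) = sum u (I - {i})"
  by (rule sum.cong) auto

lemma step_sym: "step i u v \<Longrightarrow> step i v u"
  by (auto simp: step_def)

lemma step_irrefl: "\<not> step j u u"
  by (simp add: step_def)

lemma step_dir_unique: "step i u v \<Longrightarrow> step j u v \<Longrightarrow> i = j"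
  by (auto simp: step_def)

lemma step_upd: "step j w w' \<Longrightarrow> j \<noteq> i \<Longrightarrow> step j (w(i := x)) (w'(i := x))"
  by (auto simp: step_def)

lemma step_eq: "step i u v \<Longrightarrow> v = u(i := v i)"
  by (auto simp: step_def)

lemma step_upd_same: "step i (w(i := x)) (w(i := y)) \<longleftrightarrow> x = y + 1 \<or> y = x + 1"
  by (auto simp: step_def)

lemma step_parity:
  assumes "finite I" "i \<in> I" "step i u v" shows "odd (sum v I) \<longleftrightarrow> even (sum u I)"
proof -
  have "sum v (I - {i}) = sum u (I - {i})" using assms(3) by (auto simp: step_def intro!: sum.cong)
  moreover have "u i = v i + 1 \<or> v i = u i + 1" using assms(3) by (simp add: step_def)
  ultimately show ?thesis
    unfolding sum.remove[OF assms(1,2), of u] sum.remove[OF assms(1,2), of v] by (elim disjE) simp_all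
qed

lemma upd_inj:
  "w \<in> box (I - {i}) k \<Longrightarrow> w' \<in> box (I - {i}) k \<Longrightarrow> w(i := x) = w'(i := y) \<longleftrightarrow> w = w' \<and> x = y"
  using box_undefined[of w "I - {i}" k i] box_undefined[of w' "I - {i}" k i]
  by (metis Diff_iff fun_upd_same fun_upd_triv fun_upd_upd insertI1)

section \<open>Summing the path estimates over parallel lines\<close>

lemma exc_lines:
  assumes "finite I" "i \<in> I" "X \<subseteq> box I k"
  shows "exc I X = (\<Sum>w\<in>box (I - {i}) k. exc1 (k i) (sum w (I - {i})) (line i w X))"
proof -
  have "exc I X = (\<Sum>u\<in>box I k. if u \<in> X then psign (sum u I) else 0)"
    unfolding exc_def using assms by (simp add: sum.If_cases Int_absorb1)
  also have "\<dots> = (\<Sum>(w, x)\<in>box (I - {i}) k \<times> {..<k i}.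
      if w(i := x) \<in> X then psign (sum w (I - {i}) + x) else 0)"
  \<comment> \<open>A vertex corresponds to its line, obtained by resetting coordinate
    \<open>i\<close> to \<open>undefined\<close>, together with its position on that line.\<close>
  proof (rule sum.reindex_bij_witness[of _ "\<lambda>(w, x). w(i := x)" "\<lambda>u. (u(i := undefined), u i)"], goal_cases)
    case (2 u)
    then show ?case using box_drop box_less assms by fastforce
  next
    case (3 b)
    then show ?case using box_undefined[of "fst b" "I - {i}" k i] by auto
  next
    case (4 b)
    then show ?case using box_upd[of "fst b" I i k "snd b"] assms by auto
  next
    case (5 u)
    have "sum u I = sum u (I - {i}) + u i" using sum.remove[OF assms(1,2), of u] by simp
    then show ?case by (simp add: sum_drop)
  qed auto
  also have "\<dots> = (\<Sum>w\<in>box (I - {i}) k. exc1 (k i) (sum w (I - {i})) (line i w X))"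
    using assms by (simp add: sum.cartesian_product[symmetric] exc1_def line_def)
  finally show ?thesis .
qed

lemma bad_lines:
  assumes "finite I" "i \<in> I"
  shows "card (bad I k X i) = (\<Sum>w\<in>box (I - {i}) k. card (bad1 (k i) (sum w (I - {i})) (line i w X)))"
proof -
  let ?S = "SIGMA w:box (I - {i}) k. bad1 (k i) (sum w (I - {i})) (line i w X)"
  let ?f = "\<lambda>(w, x, y). (w(i := x), w(i := y))"
  have "bij_betw ?f ?S (bad I k X i)"
  proof (rule bij_betw_byWitness[where f' = "\<lambda>(u, v). (u(i := undefined), u i, v i)"], goal_cases)
    case 1
    then show ?case using box_undefined[of _ "I - {i}" k i] by force
  next
    case 2
    have "u(i := v i) = v" if "(u, v) \<in> bad I k X i" for u v
      using that step_eq[of i u v] by (simp add: mem_bad)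
    then show ?case by auto
  next
    case 3
    then show ?case using assms box_upd[of _ I i k]
      by (auto simp: mem_bad bad1_def line_def sum_upd step_upd_same simp del: fun_upd_apply)
  next
    case 4
    have "(u(i := undefined), u i, v i) \<in> ?S" if "(u, v) \<in> bad I k X i" for u v
    proof -
      have uv: "u \<in> box I k" "v \<in> box I k" "u \<in> X" "v \<notin> X" "odd (sum u I)" and st: "step i u v"
        using that by (auto simp: mem_bad)
      have "sum u I = sum u (I - {i}) + u i" using sum.remove[OF assms(1,2), of u] by simp
      then have "odd (sum (u(i := undefined)) (I - {i}) + u i)" using uv sum_drop[of u i undefined I] by simp
      moreover have "u(i := v i) = v" using step_eq[OF st] by simp
      moreover have "u i = v i + 1 \<or> v i = u i + 1" using st by (simp add: step_def)
      ultimately show ?thesis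
        using uv box_drop[OF uv(1)] box_less[OF uv(1) assms(2)] box_less[OF uv(2) assms(2)]
        by (simp add: bad1_def line_def del: even_add)
    qed
    then show ?case by auto
  qed
  then have "card (bad I k X i) = card ?S" by (simp add: bij_betw_same_card)
  also have "\<dots> = (\<Sum>w\<in>box (I - {i}) k. card (bad1 (k i) (sum w (I - {i})) (line i w X)))"
    using assms by (intro card_SigmaI) auto
  finally show ?thesis .
qed

lemma exc_even:
  assumes "finite I" "i \<in> I" "X \<subseteq> box I k" "even (k i)"
  shows "exc I X \<le> int (card (bad I k X i))"
  unfolding exc_lines[OF assms(1-3)] bad_lines[OF assms(1,2)] of_nat_sum
  by (intro sum_mono exc1_even assms)

text \<open>If the sum of the path inequalities is an equality, each of them is, and the tight cases
  of \<open>exc1_even\<close> apply line by line.\<close>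

lemma exc_even_tight:
  assumes "finite I" "i \<in> I" "X \<subseteq> box I k" "even (k i)"
    and "exc I X = int (card (bad I k X i))" "w \<in> box (I - {i}) k"
  shows "line i w X \<inter> {..<k i} \<noteq> {} \<Longrightarrow> w(i := if odd (sum w (I - {i})) then 0 else k i - 1) \<in> X"
    and "\<not> {..<k i} \<subseteq> line i w X \<Longrightarrow> w(i := if odd (sum w (I - {i})) then k i - 1 else 0) \<notin> X"
proof -
  let ?a = "\<lambda>w. exc1 (k i) (sum w (I - {i})) (line i w X)"
  let ?b = "\<lambda>w. int (card (bad1 (k i) (sum w (I - {i})) (line i w X)))"
  have le: "?a w' \<le> ?b w'" for w' using exc1_even(1) assms(4) .
  have "sum ?a (box (I - {i}) k) = sum ?b (box (I - {i}) k)"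
    using assms(5) unfolding exc_lines[OF assms(1-3)] bad_lines[OF assms(1,2)] of_nat_sum .
  then have "?a w = ?b w"
    using sum_mono_inv[of ?a "box (I - {i}) k" ?b w] le assms(1,6) by auto
  from exc1_even(2,3)[OF assms(4) this]
  show "line i w X \<inter> {..<k i} \<noteq> {} \<Longrightarrow> w(i := if odd (sum w (I - {i})) then 0 else k i - 1) \<in> X"
    and "\<not> {..<k i} \<subseteq> line i w X \<Longrightarrow> w(i := if odd (sum w (I - {i})) then k i - 1 else 0) \<notin> X"
    by (auto simp: line_def)
qed

text \<open>The corrections in \<open>exc1_odd_even\<close> and \<open>exc1_odd_odd\<close> are the
  signs of the lines selected by \<open>proj\<close>: -1 for an even line meeting \<open>X\<close>,
  +1 for an odd line inside \<open>X\<close>. They add up to the excess of the projection.\<close>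

lemma exc_odd:
  assumes "finite I" "i \<in> I" "X \<subseteq> box I k" "odd (k i)"
  shows "exc I X \<le> int (card (bad I k X i)) + exc (I - {i}) (proj I k i X)"
proof -
  let ?I = "I - {i}" and ?B = "box (I - {i}) k"
  have "exc ?I (proj I k i X) = (\<Sum>w\<in>?B. if w \<in> proj I k i X then psign (sum w ?I) else 0)"
    unfolding exc_def using assms proj_subset[of I k i X] by (simp add: sum.If_cases Int_absorb1)
  moreover have "exc1 (k i) (sum w ?I) (line i w X) \<le> int (card (bad1 (k i) (sum w ?I) (line i w X)))
      + (if w \<in> proj I k i X then psign (sum w ?I) else 0)" if "w \<in> ?B" for w
    using exc1_odd_even[OF assms(4), of "sum w ?I" "line i w X"]
      exc1_odd_odd[OF assms(4), of "sum w ?I" "line i w X"] that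
    by (cases "odd (sum w ?I)"; cases "{..<k i} \<subseteq> line i w X"; cases "line i w X \<inter> {..<k i} = {}")
      (simp_all add: proj_def psign_def)
  ultimately show ?thesis
    unfolding exc_lines[OF assms(1-3)] bad_lines[OF assms(1,2)] of_nat_sum
    by (auto simp: sum.distrib[symmetric] intro!: sum_mono)
qed

section \<open>Lifting edges of a projection to parallel layers\<close>

lemma lift_inj:
  "inj_on (\<lambda>((w, w'), x). (w(i := x), w'(i := x))) ((box (I - {i}) k \<times> box (I - {i}) k) \<times> UNIV)"
  by (auto simp: inj_on_def upd_inj)

lemma lift_card:
  assumes "finite R" "Q \<subseteq> box (I - {i}) k \<times> box (I - {i}) k"
    and "\<And>w w' x. (w, w') \<in> Q \<Longrightarrow> x \<in> P \<Longrightarrow> (w(i := x), w'(i := x)) \<in> R"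
  shows "card Q * card P \<le> card R"
proof -
  have "card (Q \<times> P) \<le> card R"
    by (rule card_inj_on_le[where f = "\<lambda>((w, w'), x). (w(i := x), w'(i := x))"])
      (use assms in \<open>auto intro: inj_on_subset[OF lift_inj]\<close>)
  then show ?thesis by (simp add: card_cartesian_product)
qed

text \<open>A bad edge of the projection leads from an odd line inside \<open>X\<close> to an even
  line disjoint from \<open>X\<close>. Each even position on these lines gives a bad edge of
  \<open>X\<close>, and an odd side has room for the positions 0 and 2.\<close>

lemma bad_proj_card:
  assumes "finite I" "i \<in> I" "j \<noteq> i" "odd (k i)" "k i \<ge> 2"
  shows "2 * card (bad (I - {i}) k (proj I k i X) j) \<le> card (bad I k X j)"
proof (cases "j \<in> I")
  case True
  have "k i \<noteq> 2" using assms(4) by auto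
  then have k: "k i \<ge> 3" using assms(5) by simp
  have "(w(i := x), w'(i := x)) \<in> bad I k X j"
    if "(w, w') \<in> bad (I - {i}) k (proj I k i X) j" "x \<in> {0, 2}" for w w' x
  proof -
    have "odd (sum w (I - {i}))" "even (sum w' (I - {i}))"
      using that step_parity[of "I - {i}" j w w'] assms True by (auto simp: mem_bad)
    then have "{..<k i} \<subseteq> line i w X" "line i w' X \<inter> {..<k i} = {}"
      using that by (auto simp: mem_bad proj_def)
    moreover have "x < k i" using that k by auto
    ultimately have "w(i := x) \<in> X" "w'(i := x) \<notin> X" by (auto simp: line_def)
    moreover have "odd (sum (w(i := x)) I)"
      using \<open>odd (sum w (I - {i}))\<close> that assms by (auto simp: sum_upd simp del: fun_upd_apply)
    ultimately show ?thesis using that assms box_upd[of _ I i k x] step_upd[of j w w' i x]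
        \<open>x < k i\<close> by (auto simp: mem_bad)
  qed
  then have "card (bad (I - {i}) k (proj I k i X) j) * card {0, 2::nat} \<le> card (bad I k X j)"
    using assms by (intro lift_card) (auto simp: mem_bad)
  then show ?thesis by simp
next
  case False
  have "bad (I - {i}) k (proj I k i X) j = {}"
  proof -
    have False if "(w, w') \<in> bad (I - {i}) k (proj I k i X) j" for w w'
      using that False box_undefined[of w "I - {i}" k j] box_undefined[of w' "I - {i}" k j]
      by (auto simp: mem_bad step_def)
    then show ?thesis by auto
  qed
  then show ?thesis by simp
qed

text \<open>An edge-isoperimetric bound. If some direction has no boundary edge, then
  \<open>Z\<close> is a cylinder over a set \<open>Y\<close> of one dimension less, and each
  boundary edge of \<open>Y\<close> lifts to two of \<open>Z\<close>, which outweighs the lost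
  direction.\<close>

lemma bnd_card_ge:
  assumes "finite I" "\<And>i. i \<in> I \<Longrightarrow> k i \<ge> 2" "Z \<subseteq> box I k" "Z \<noteq> {}" "Z \<noteq> box I k"
  shows "(\<Sum>i\<in>I. card (bnd I k Z i)) \<ge> card I"
  using assms
proof (induction I arbitrary: Z rule: finite_psubset_induct)
  case (psubset I)
  show ?case
  proof (cases "\<forall>i\<in>I. bnd I k Z i \<noteq> {}")
    case True
    then have "card (bnd I k Z i) \<ge> 1" if "i \<in> I" for i
      using that psubset.hyps by (simp add: Suc_leI card_gt_0_iff)
    then have "(\<Sum>i\<in>I. card (bnd I k Z i)) \<ge> (\<Sum>i\<in>I. 1)" by (intro sum_mono) auto
    then show ?thesis by simp
  next
    case False
    then obtain i where i: "i \<in> I" "bnd I k Z i = {}" by auto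
    let ?I = "I - {i}"
    define Y where "Y = {w \<in> box ?I k. w(i := 0) \<in> Z}"
    have fin: "finite ?I" and card: "card I = Suc (card ?I)"
      using psubset.hyps i card.remove[of I i] by auto
    have k: "k i \<ge> 2" using psubset.prems i by auto
    have const: "w(i := x) \<in> Z \<longleftrightarrow> w(i := 0) \<in> Z" if w: "w \<in> box ?I k" and "x < k i" for w x
      using \<open>x < k i\<close>
    proof (induction x)
      case 0
      show ?case by (rule refl)
    next
      case (Suc x)
      have "step i (w(i := x)) (w(i := Suc x))" by (simp add: step_upd_same)
      moreover have "w(i := x) \<in> box I k" "w(i := Suc x) \<in> box I k"
        by (rule box_upd[OF w i(1)], use Suc.prems in simp)+
      moreover have "(w(i := x), w(i := Suc x)) \<notin> bnd I k Z i" "(w(i := Suc x), w(i := x)) \<notin> bnd I k Z i"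
        using i by simp_all
      ultimately have "w(i := Suc x) \<in> Z \<longleftrightarrow> w(i := x) \<in> Z"
        using step_sym[of i "w(i := x)" "w(i := Suc x)"] unfolding mem_bnd by argo
      also have "\<dots> \<longleftrightarrow> w(i := 0) \<in> Z" by (rule Suc.IH[OF Suc_lessD[OF Suc.prems]])
      finally show ?case .
    qed
    have mem: "u \<in> Z \<longleftrightarrow> u(i := undefined) \<in> Y" if "u \<in> box I k" for u
    proof -
      have "u \<in> Z \<longleftrightarrow> u(i := 0) \<in> Z"
        using const[OF box_drop[OF that], of "u i"] box_less[OF that i(1)]
        unfolding fun_upd_upd fun_upd_triv by blast
      then show ?thesis using box_drop[OF that, of i] unfolding Y_def mem_Collect_eq fun_upd_upd by blast
    qed
    have "Y \<noteq> {}" using mem psubset.prems(2,3) by (metis all_not_in_conv subsetD)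
    moreover have "Y \<noteq> box ?I k"
    proof
      assume "Y = box ?I k"
      then have "box I k \<subseteq> Z" using mem box_drop[of _ I k i] by auto
      then show False using psubset.prems(2,4) by simp
    qed
    moreover have "Y \<subseteq> box ?I k" "?I \<subset> I" using i by (auto simp: Y_def)
    ultimately have IH: "(\<Sum>j\<in>?I. card (bnd ?I k Y j)) \<ge> card ?I"
      using psubset.IH[of ?I Y] psubset.prems(1) by blast
    have "2 * card (bnd ?I k Y j) \<le> card (bnd I k Z j)" if "j \<in> ?I" for j
    proof -
      have "card (bnd ?I k Y j) * card {0, 1::nat} \<le> card (bnd I k Z j)"
      proof (rule lift_card)
        fix w w' x assume *: "(w, w') \<in> bnd ?I k Y j" "x \<in> {0, 1::nat}"
        then have "x < k i" using k by auto
        then have "w(i := x) \<in> Z" "w'(i := x) \<notin> Z"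
          using * const[of w x] const[of w' x] unfolding mem_bnd Y_def mem_Collect_eq by blast+
        then show "(w(i := x), w'(i := x)) \<in> bnd I k Z j"
          using * \<open>x < k i\<close> i that box_upd[of w I i k x] box_upd[of w' I i k x]
            step_upd[of j w w' i x] unfolding mem_bnd by blast
      qed (use psubset.hyps in \<open>auto simp: mem_bnd\<close>)
      then show ?thesis by simp
    qed
    then have "2 * (\<Sum>j\<in>?I. card (bnd ?I k Y j)) \<le> (\<Sum>j\<in>?I. card (bnd I k Z j))"
      unfolding sum_distrib_left by (rule sum_mono)
    also have "\<dots> \<le> (\<Sum>j\<in>I. card (bnd I k Z j))" using psubset.hyps by (intro sum_mono2) auto
    finally have 2: "2 * card ?I \<le> (\<Sum>j\<in>I. card (bnd I k Z j))" using IH by linarith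
    \<comment> \<open>The doubled bound \<open>2 * card ?I\<close> reaches \<open>card I\<close>
      except in dimension 1. There the projected box is a single point and has no proper nonempty
      subset.\<close>
    have "card ?I \<noteq> 0"
    proof
      assume "card ?I = 0"
      then have "?I = {}" using fin by simp
      then have "box ?I k = {\<lambda>_. undefined}" by (simp only: box_def PiE_empty_domain)
      then show False using \<open>Y \<noteq> {}\<close> \<open>Y \<noteq> box ?I k\<close> \<open>Y \<subseteq> box ?I k\<close> by (metis subset_singletonD)
    qed
    then show ?thesis using 2 card by linarith
  qed
qed

section \<open>Boxes with odd sides\<close>

lemma exc_card:
  assumes "finite X"
  shows "exc I X = int (card {u \<in> X. odd (sum u I)}) - int (card {u \<in> X. even (sum u I)})"
proof -
  have "exc I X = (\<Sum>u\<in>X. if odd (sum u I) then 1 else - 1)"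
    by (simp add: exc_def psign_def)
  also have "\<dots> = (\<Sum>u\<in>X \<inter> {u. odd (sum u I)}. 1) + (\<Sum>u\<in>X \<inter> - {u. odd (sum u I)}. - 1)"
    using assms by (rule sum.If_cases)
  also have "X \<inter> {u. odd (sum u I)} = {u \<in> X. odd (sum u I)}" by auto
  also have "X \<inter> - {u. odd (sum u I)} = {u \<in> X. even (sum u I)}" by auto
  finally show ?thesis by simp
qed

lemma exc_ge1_odd:
  assumes "finite X" "exc I X \<ge> 1" obtains u where "u \<in> X" "odd (sum u I)"
proof -
  have "card {u \<in> X. odd (sum u I)} \<noteq> 0" using assms exc_card[OF assms(1), of I] by linarith
  then have "{u \<in> X. odd (sum u I)} \<noteq> {}" by fastforce
  then show ?thesis using that by blast
qed

lemma exc_no_odd: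
  assumes "finite X" "\<And>u. u \<in> X \<Longrightarrow> even (sum u I)" shows "exc I X = - int (card X)"
proof -
  have "{u \<in> X. odd (sum u I)} = {}" "{u \<in> X. even (sum u I)} = X" using assms by auto
  then show ?thesis by (simp only: exc_card[OF assms(1), of I]) simp
qed

lemma exc_eq_singleton:
  assumes "finite X" "exc I X \<ge> 1" "card {u \<in> X. odd (sum u I)} \<le> 1"
  shows "\<exists>u. X = {u} \<and> odd (sum u I)"
proof -
  have "card {u \<in> X. odd (sum u I)} = 1" "card {u \<in> X. even (sum u I)} = 0"
    using exc_card[OF assms(1), of I] assms(2,3) by linarith+
  then obtain u where "{u \<in> X. odd (sum u I)} = {u}" "{u \<in> X. even (sum u I)} = {}"
    using assms(1) by (auto simp: card_1_singleton_iff)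
  then have "X = {u} \<and> odd (sum u I)" by blast
  then show ?thesis by blast
qed

lemma ex_step:
  assumes "u \<in> box I k" "j \<in> I" "k j \<ge> 2"
  obtains v where "v \<in> box I k" "step j u v"
proof (cases "u j = 0")
  case True
  have "u(j := 1) \<in> box I k" using assms by (intro box_upd_same) auto
  moreover have "step j u (u(j := 1))" using True by (auto simp: step_def)
  ultimately show ?thesis using that by blast
next
  case False
  have "u(j := u j - 1) \<in> box I k" using box_less[OF assms(1,2)] assms by (intro box_upd_same) auto
  moreover have "step j u (u(j := u j - 1))" using False by (auto simp: step_def)
  ultimately show ?thesis using that by blast
qed

text \<open>Choose one neighbour in direction \<open>j\<close> for each member of \<open>S\<close>;
  the resulting bad pairs differ in their first component.\<close>

lemma bad_ge:
  assumes "finite I" "j \<in> I" "k j \<ge> 2" "X \<subseteq> box I k" "S \<subseteq> {u \<in> X. odd (sum u I)}"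
    and "\<And>u v. u \<in> S \<Longrightarrow> v \<in> box I k \<Longrightarrow> step j u v \<Longrightarrow> v \<notin> X"
  shows "card S \<le> card (bad I k X j)"
proof -
  have "\<exists>v. v \<in> box I k \<and> step j u v" if "u \<in> S" for u
    using ex_step[of u I k j] assms(2-5) that by blast
  then obtain f where f: "\<And>u. u \<in> S \<Longrightarrow> f u \<in> box I k \<and> step j u (f u)" by metis
  have "(\<lambda>u. (u, f u)) ` S \<subseteq> bad I k X j"
  proof (rule image_subsetI)
    fix u assume "u \<in> S"
    then have "u \<in> X" "odd (sum u I)" "u \<in> box I k" using assms(4,5) by blast+
    then show "(u, f u) \<in> bad I k X j" using f[OF \<open>u \<in> S\<close>] assms(6)[OF \<open>u \<in> S\<close>] by (simp add: mem_bad)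
  qed
  moreover have "inj_on (\<lambda>u. (u, f u)) S" by (auto simp: inj_on_def)
  ultimately show ?thesis using card_inj_on_le[OF _ _ finite_bad[OF assms(1)]] by blast
qed

text \<open>An odd coordinate on an odd side is neither first nor last, so both neighbours exist and
  both give bad edges.\<close>

lemma bad_ge2:
  assumes "finite I" "j \<in> I" "odd (k j)" "X \<subseteq> box I k" "S \<subseteq> {u \<in> X. odd (sum u I)}"
    and "\<And>u. u \<in> S \<Longrightarrow> odd (u j)"
    and "\<And>u v. u \<in> S \<Longrightarrow> v \<in> box I k \<Longrightarrow> step j u v \<Longrightarrow> v \<notin> X"
  shows "2 * card S \<le> card (bad I k X j)"
proof -
  have fin: "finite S" using assms(1,4,5) finite_subset[OF assms(4)] finite_subset[OF assms(5)] by auto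
  let ?f = "\<lambda>(u, b). (u, u(j := if b then u j + 1 else u j - 1))"
  have "?f (u, b) \<in> bad I k X j" if "u \<in> S" for u b
  proof -
    have u: "u \<in> box I k" "u \<in> X" "odd (sum u I)" "odd (u j)" using that assms(4-6) by auto
    have "u j < k j" using box_less[OF u(1) assms(2)] .
    moreover have "Suc (u j) \<noteq> k j" using u(4) assms(3) by (metis even_Suc)
    moreover have "u j \<noteq> 0" using u(4) odd_pos by blast
    ultimately have "u j < k j" "u j + 1 < k j" "u j \<noteq> 0" by simp_all
    then have v: "u(j := if b then u j + 1 else u j - 1) \<in> box I k"
      using u(1) assms(2) by (intro box_upd_same) auto
    have "step j u (u(j := if b then u j + 1 else u j - 1))" using \<open>u j \<noteq> 0\<close> by (auto simp: step_def)
    then show ?thesis using u v assms(7)[OF that v] by (simp add: mem_bad)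
  qed
  then have "?f ` (S \<times> UNIV) \<subseteq> bad I k X j" by auto
  moreover have "inj_on ?f (S \<times> UNIV)"
  proof (rule inj_onI)
    fix p q assume "p \<in> S \<times> UNIV" "q \<in> S \<times> UNIV" and eq: "?f p = ?f q"
    obtain u b u' b' where pq: "p = (u, b)" "q = (u', b')" by fastforce
    then have "u' = u" and upd: "u(j := if b then u j + 1 else u j - 1) = u(j := if b' then u j + 1 else u j - 1)"
      using eq by auto
    from fun_cong[OF upd, of j]
    have "(if b then u j + 1 else u j - 1) = (if b' then u j + 1 else u j - 1)"
      unfolding fun_upd_same .
    then have "b = b'" by (auto split: if_splits)
    then show "p = q" using pq \<open>u' = u\<close> by simp
  qed
  ultimately have "card (S \<times> (UNIV :: bool set)) \<le> card (bad I k X j)"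
    using card_inj_on_le[OF _ _ finite_bad[OF assms(1)]] by blast
  then show ?thesis by (simp add: card_cartesian_product)
qed

section \<open>Consequences of an empty projection\<close>

lemma proj_empty_odd:
  assumes "finite I" "i \<in> I" "X \<subseteq> box I k" "proj I k i X = {}" "u \<in> X"
  shows "odd (sum u (I - {i}))"
proof (rule ccontr)
  assume even: "\<not> odd (sum u (I - {i}))"
  have u: "u \<in> box I k" using assms by auto
  have "u i \<in> line i (u(i := undefined)) X \<inter> {..<k i}"
    using assms box_less[OF u assms(2)] by (simp add: line_def)
  then have "u(i := undefined) \<in> proj I k i X"
    using even box_drop[OF u, of i] sum_drop[of u i undefined I] by (auto simp: proj_def)
  then show False using assms(4) by simp
qed

text \<open>A step in another direction changes the parity of the line, whereas an empty projection
  confines \<open>X\<close> to odd lines.\<close>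

lemma proj_empty_nbr:
  assumes "finite I" "i \<in> I" "X \<subseteq> box I k" "proj I k i X = {}" "j \<in> I" "j \<noteq> i" "u \<in> X" "step j u v"
  shows "v \<notin> X"
proof
  assume "v \<in> X"
  then have "odd (sum v (I - {i}))" "odd (sum u (I - {i}))"
    using proj_empty_odd[OF assms(1-4)] assms(7) by simp_all
  then show False using step_parity[of "I - {i}" j u v] assms(1,5,6,8) by simp
qed

lemma bad_proj_sum:
  assumes "finite I" "i \<in> I" "odd (k i)" "k i \<ge> 2"
  shows "2 * (\<Sum>j\<in>I - {i}. card (bad (I - {i}) k (proj I k i X) j)) + card (bad I k X i)
    \<le> (\<Sum>j\<in>I. card (bad I k X j))"
proof -
  have "2 * (\<Sum>j\<in>I - {i}. card (bad (I - {i}) k (proj I k i X) j)) \<le> (\<Sum>j\<in>I - {i}. card (bad I k X j))"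
    unfolding sum_distrib_left using assms by (intro sum_mono bad_proj_card) auto
  then show ?thesis using sum.remove[OF assms(1,2), of "\<lambda>j. card (bad I k X j)"] by linarith
qed

lemma all_coords_even:
  fixes u :: "'i \<Rightarrow> nat"
  assumes "finite I" "\<And>i. i \<in> I \<Longrightarrow> odd (sum u (I - {i}))" "odd (sum u I)" shows False
proof -
  have "even (u i)" if "i \<in> I" for i
    using sum.remove[OF assms(1) that, of u] assms(2)[OF that] assms(3) by simp
  then have "even (sum u I)" by (rule dvd_sum)
  then show False using assms(3) by simp
qed

lemma sum_eq_ones:
  fixes e :: "'i \<Rightarrow> nat"
  assumes "finite I" "\<And>i. i \<in> I \<Longrightarrow> e i \<ge> 1" "sum e I \<le> card I" "i \<in> I" shows "e i = 1"
proof -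
  have "(\<Sum>j\<in>I - {i}. 1) \<le> sum e (I - {i})" using assms(2) by (intro sum_mono) auto
  then have "card (I - {i}) \<le> sum e (I - {i})" by simp
  moreover have "card I = Suc (card (I - {i}))" using card.remove[OF assms(1,4)] .
  ultimately show ?thesis using sum.remove[OF assms(1,4), of e] assms(2)[OF assms(4)] assms(3) by linarith
qed

lemma sum_ge_card:
  fixes e :: "'i \<Rightarrow> nat"
  assumes "\<And>i. i \<in> I \<Longrightarrow> e i \<ge> 1" shows "card I \<le> sum e I"
proof -
  have "(\<Sum>j\<in>I. 1) \<le> sum e I" using assms by (intro sum_mono) auto
  then show ?thesis by simp
qed

text \<open>The second claim serves the induction, where projections of excess 0 occur. For excess
  0, asking for an odd vertex merely excludes the empty set.\<close>

lemma odd_box_bad: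
  assumes "finite I" "\<And>i. i \<in> I \<Longrightarrow> k i \<ge> 2" "\<And>i. i \<in> I \<Longrightarrow> odd (k i)" "X \<subseteq> box I k"
  shows "(exc I X \<ge> 1 \<longrightarrow> card I + 1 \<le> (\<Sum>j\<in>I. card (bad I k X j))) \<and>
    (exc I X = 0 \<and> (\<exists>u\<in>X. odd (sum u I)) \<longrightarrow> card I \<le> (\<Sum>j\<in>I. card (bad I k X j)))"
  using assms
proof (induction I arbitrary: X rule: finite_psubset_induct)
  case (psubset I)
  let ?e = "\<lambda>j. card (bad I k X j)"
  let ?P = "\<lambda>i. proj I k i X"
  let ?c = "\<lambda>i. \<Sum>j\<in>I - {i}. card (bad (I - {i}) k (?P i) j)"
  have finX: "finite X" using psubset.hyps psubset.prems(3) finite_box finite_subset by blast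
  have IH: "(exc (I - {i}) (?P i) \<ge> 1 \<longrightarrow> card (I - {i}) + 1 \<le> ?c i) \<and>
      (exc (I - {i}) (?P i) = 0 \<and> (\<exists>u\<in>?P i. odd (sum u (I - {i}))) \<longrightarrow> card (I - {i}) \<le> ?c i)" if "i \<in> I" for i
  proof (rule psubset.IH)
    show "I - {i} \<subset> I" using that by blast
  qed (use psubset.prems(1,2) proj_subset[of I k i X] in simp_all)
  have IH1: "exc (I - {i}) (?P i) \<ge> 1 \<Longrightarrow> card (I - {i}) + 1 \<le> ?c i"
    and IH0: "exc (I - {i}) (?P i) = 0 \<Longrightarrow> \<exists>u\<in>?P i. odd (sum u (I - {i})) \<Longrightarrow> card (I - {i}) \<le> ?c i"
    if "i \<in> I" for i using IH[OF that] by blast+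
  have sum: "2 * ?c i + ?e i \<le> sum ?e I" if "i \<in> I" for i
    by (rule bad_proj_sum[where k = k, OF psubset.hyps that psubset.prems(2)[OF that] psubset.prems(1)[OF that]])
  have exc: "exc I X \<le> int (?e i) + exc (I - {i}) (?P i)" if "i \<in> I" for i
    by (rule exc_odd[where k = k, OF psubset.hyps that psubset.prems(3,2)]) (rule that)
  have cI: "card I = Suc (card (I - {i}))" if "i \<in> I" for i
    using card.remove[OF psubset.hyps that] .
  \<comment> \<open>The last premise leaves the count to each of the two claims. An odd member of
    the projection would force dimension 1, where the sum is empty and thus even; without odd
    members, excess 0 means empty.\<close>
  have P0: "?P i = {}" if "i \<in> I" "exc (I - {i}) (?P i) = 0" "2 * card (I - {i}) + ?e i \<le> sum ?e I \<Longrightarrow> card (I - {i}) = 0" for i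
  proof (cases "\<exists>u\<in>?P i. odd (sum u (I - {i}))")
    case True
    then have "card (I - {i}) \<le> ?c i" using IH0[OF that(1,2)] by blast
    then have "card (I - {i}) = 0" using that(3) sum[OF that(1)] by linarith
    then have "I - {i} = {}" using psubset.hyps by simp
    then show ?thesis using True by (metis sum.empty even_zero)
  next
    case False
    then have "exc (I - {i}) (?P i) = - int (card (?P i))"
      using psubset.hyps by (intro exc_no_odd) auto
    then show ?thesis using that(2) psubset.hyps by simp
  qed
  \<comment> \<open>A projection of positive excess would yield too many bad edges. So every
    \<open>?e i\<close> is at least 1, hence equal to 1, and all projections have excess 0 and are
    empty; the coordinates of an odd vertex then contradict parity.\<close>
  have 1: "card I + 1 \<le> sum ?e I" if ex1: "exc I X \<ge> 1"
  proof (rule ccontr)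
    assume "\<not> ?thesis"
    then have c: "sum ?e I \<le> card I" by simp
    have le0: "exc (I - {i}) (?P i) \<le> 0" if "i \<in> I" for i
      using IH1[OF that] sum[OF that] c cI[OF that] by linarith
    then have "?e i \<ge> 1" if "i \<in> I" for i using exc[OF that] ex1 le0[OF that] by linarith
    then have e1: "?e i = 1" if "i \<in> I" for i
      using sum_eq_ones[of I ?e i] psubset.hyps c that by blast
    have "?P i = {}" if "i \<in> I" for i
    proof (rule P0[OF that])
      show "exc (I - {i}) (?P i) = 0" using exc[OF that] ex1 le0[OF that] e1[OF that] by linarith
      show "card (I - {i}) = 0" if "2 * card (I - {i}) + ?e i \<le> sum ?e I"
        using that c cI[OF \<open>i \<in> I\<close>] e1[OF \<open>i \<in> I\<close>] by linarith
    qed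
    moreover obtain u where "u \<in> X" "odd (sum u I)" using exc_ge1_odd[OF finX ex1] by blast
    ultimately show False
      using all_coords_even[of I u] proj_empty_odd[where k = k, OF psubset.hyps _ psubset.prems(3)] psubset.hyps by blast
  qed
  moreover have "card I \<le> sum ?e I" if ex0: "exc I X = 0" and u: "u \<in> X" "odd (sum u I)" for u
  proof (rule ccontr)
    assume c: "\<not> ?thesis"
    then obtain i where i: "i \<in> I" "?e i = 0" using sum_ge_card[of I ?e] by force
    have "exc (I - {i}) (?P i) = 0"
      using exc[OF i(1)] i(2) ex0 IH1[OF i(1)] sum[OF i(1)] c cI[OF i(1)] by linarith
    then have P: "?P i = {}" using P0[OF i(1)] c cI[OF i(1)] i(2) by linarith
    have "odd (sum u (I - {i}))" using proj_empty_odd[where k = k, OF psubset.hyps i(1) psubset.prems(3) P u(1)] .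
    \<comment> \<open>All neighbours of \<open>u\<close> in directions other than \<open>i\<close>
      lie outside \<open>X\<close>. The odd coordinate supplies two bad edges in direction
      \<open>j\<close>, making up for the missing one in direction \<open>i\<close>.\<close>
    then obtain j where j: "j \<in> I - {i}" "odd (u j)" by (meson dvd_sum)
    have nbr: "v \<notin> X" if "l \<in> I - {i}" "step l u v" for l v
      using proj_empty_nbr[where k = k, OF psubset.hyps i(1) psubset.prems(3) P _ _ u(1) that(2)] that(1) by blast
    have "?e l \<ge> 1" if "l \<in> I - {i}" for l
      using bad_ge[of I l k X "{u}"] nbr[OF that] that psubset.hyps psubset.prems u by auto
    then have "card (I - {i} - {j}) \<le> sum ?e (I - {i} - {j})" by (intro sum_ge_card) auto
    moreover have "?e j \<ge> 2"
      using bad_ge2[of I j k X "{u}"] nbr[OF j(1)] j psubset.hyps psubset.prems u by auto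
    moreover have "sum ?e (I - {i}) = ?e j + sum ?e (I - {i} - {j})"
      using j psubset.hyps by (intro sum.remove) auto
    moreover have "sum ?e I = ?e i + sum ?e (I - {i})"
      using i psubset.hyps by (intro sum.remove) auto
    moreover have "card (I - {i}) = Suc (card (I - {i} - {j}))"
      using j psubset.hyps by (intro card.remove) auto
    ultimately show False using c cI[OF i(1)] by linarith
  qed
  ultimately show ?case by blast
qed

text \<open>The induction alone leaves e_i = 1, e_j = 2 open in dimension 2; this lemma excludes it by
  counting in the direction j.\<close>

lemma proj_two_dim_exc:
  assumes "I = {i, j}" "i \<noteq> j" "odd (k i)" "k i \<ge> 2" "k j \<ge> 2" "X \<subseteq> box I k"
    and full: "w \<in> proj I k i X" "odd (sum w (I - {i}))"
    and empty: "w' \<in> box (I - {i}) k" "w' \<notin> proj I k i X" "even (sum w' (I - {i}))"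
  shows "exc (I - {j}) (proj I k j X) \<le> - 2"
proof -
  have Ii: "I - {i} = {j}" "I - {j} = {i}" using assms(1,2) by auto
  have fin: "finite I" using assms(1) by simp
  have lw: "{..<k i} \<subseteq> line i w X" using full by (simp add: proj_def)
  have lw': "line i w' X \<inter> {..<k i} = {}" using empty by (simp add: proj_def)
  have w: "w \<in> box {j} k" using full proj_subset[of I k i X] Ii by auto
  \<comment> \<open>An odd line of \<open>proj I k j X\<close> would lie inside \<open>X\<close> and
    cross the line of \<open>w'\<close>, which is disjoint from \<open>X\<close>.\<close>
  have even: "even (sum v (I - {j}))" if v: "v \<in> proj I k j X" for v
  proof (rule ccontr)
    assume "odd (sum v (I - {j}))"
    then have "{..<k j} \<subseteq> line j v X" using v by (simp add: proj_def)
    moreover have "w' j < k j" using empty(1) Ii box_less[of w' "{j}" k j] by simp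
    ultimately have "v(j := w' j) \<in> X" by (auto simp: line_def)
    moreover have vb: "v \<in> box {i} k" using v proj_subset[of I k j X] Ii by auto
    have "v(j := w' j) = w'(i := v i)"
    proof
      fix x show "(v(j := w' j)) x = (w'(i := v i)) x"
        using box_undefined[of v "{i}" k x] box_undefined[of w' "{j}" k x] vb empty(1) Ii assms(2)
        by (cases "x = i"; cases "x = j") simp_all
    qed
    moreover have "v i < k i" using vb box_less[of v "{i}" k i] by simp
    ultimately show False using lw' by (auto simp: line_def)
  qed
  \<comment> \<open>\<open>?z x\<close> is the line in direction \<open>j\<close> at coordinate
    \<open>x\<close>. For \<open>x\<close> equal to 0 or 2 it is even, and it meets \<open>X\<close>
    where it crosses the full line of \<open>w\<close>.\<close>
  let ?z = "\<lambda>x::nat. (\<lambda>_. undefined)(i := x)"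
  have "k i \<ge> 3" using assms(3,4) by (cases "k i = 2") auto
  then have "?z x \<in> proj I k j X" if "x \<in> {0, 2}" for x
  proof -
    have x: "x < k i" using that \<open>k i \<ge> 3\<close> by auto
    have zb: "?z x \<in> box (I - {j}) k" using x Ii by (simp add: box_def PiE_iff extensional_def)
    have "(?z x)(j := w j) = w(i := x)"
    proof
      fix y show "((?z x)(j := w j)) y = (w(i := x)) y"
        using box_undefined[of w "{j}" k y] w assms(2) by (cases "y = i"; cases "y = j") simp_all
    qed
    moreover have "w(i := x) \<in> X" using lw x by (auto simp: line_def)
    ultimately have "w j \<in> line j (?z x) X" by (simp add: line_def)
    moreover have "w j < k j" using w box_less[of w "{j}" k j] by simp
    ultimately have "line j (?z x) X \<inter> {..<k j} \<noteq> {}" by auto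
    moreover have "sum (?z x) (I - {j}) = x" unfolding Ii by simp
    then have "even (sum (?z x) (I - {j}))" using that by auto
    ultimately show ?thesis using zb by (simp add: proj_def)
  qed
  then have "{?z 0, ?z 2} \<subseteq> proj I k j X" by blast
  moreover have "?z 0 \<noteq> ?z 2"
  proof
    assume "?z 0 = ?z 2"
    from fun_cong[OF this, of i] show False unfolding fun_upd_same by simp
  qed
  ultimately have "2 \<le> card (proj I k j X)"
    using card_mono[OF finite_proj[OF fin, of k j X], of "{?z 0, ?z 2}"] by simp
  then show ?thesis using exc_no_odd[OF finite_proj[OF fin] even] by simp
qed

text \<open>A direction with a single bad edge has an empty projection. By parity this cannot hold
  in all directions, so one direction \<open>l\<close> carries two bad edges and the others one
  each. Every odd vertex of \<open>X\<close> takes two bad edges in direction \<open>l\<close>, so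
  there is only one.\<close>

lemma odd_box_bad_eq:
  assumes "finite I" "\<And>i. i \<in> I \<Longrightarrow> k i \<ge> 2" "\<And>i. i \<in> I \<Longrightarrow> odd (k i)" "X \<subseteq> box I k"
    and "card I \<ge> 2" "exc I X \<ge> 1" "(\<Sum>j\<in>I. card (bad I k X j)) \<le> card I + 1"
  shows "\<exists>u. X = {u} \<and> odd (sum u I)"
proof -
  let ?e = "\<lambda>j. card (bad I k X j)"
  let ?P = "\<lambda>i. proj I k i X"
  let ?c = "\<lambda>i. \<Sum>j\<in>I - {i}. card (bad (I - {i}) k (?P i) j)"
  have finX: "finite X" using assms(4) finite_box[OF assms(1)] by (rule finite_subset)
  have IH: "(exc (I - {i}) (?P i) \<ge> 1 \<longrightarrow> card (I - {i}) + 1 \<le> ?c i) \<and>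
      (exc (I - {i}) (?P i) = 0 \<and> (\<exists>u\<in>?P i. odd (sum u (I - {i}))) \<longrightarrow> card (I - {i}) \<le> ?c i)" for i
    by (rule odd_box_bad) (use assms proj_subset[of I k i X] in auto)
  have sum: "2 * ?c i + ?e i \<le> sum ?e I" if "i \<in> I" for i
    by (rule bad_proj_sum[where k = k, OF assms(1) that assms(3)[OF that] assms(2)[OF that]])
  have exc: "exc I X \<le> int (?e i) + exc (I - {i}) (?P i)" if "i \<in> I" for i
    by (rule exc_odd[where k = k, OF assms(1) that assms(4,3)]) (rule that)
  have cI: "card I = Suc (card (I - {i}))" if "i \<in> I" for i
    using card.remove[OF assms(1) that] .
  have le0: "exc (I - {i}) (?P i) \<le> 0" if "i \<in> I" for i
    using conjunct1[OF IH[of i]] sum[OF that] assms(5,7) cI[OF that] by linarith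
  have e1: "?e i \<ge> 1" if "i \<in> I" for i using exc[OF that] assms(6) le0[OF that] by linarith
  have P0: "?P i = {}" if i: "i \<in> I" "?e i = 1" for i
  proof (rule ccontr)
    assume ne: "?P i \<noteq> {}"
    have exc0: "exc (I - {i}) (?P i) = 0" using exc[OF i(1)] le0[OF i(1)] i(2) assms(6) by linarith
    have "\<exists>w\<in>?P i. odd (sum w (I - {i}))"
    proof (rule ccontr)
      assume "\<not> ?thesis"
      then have "exc (I - {i}) (?P i) = - int (card (?P i))"
        using assms(1) by (intro exc_no_odd) auto
      then show False using ne exc0 assms(1) by simp
    qed
    then obtain w where w: "w \<in> ?P i" "odd (sum w (I - {i}))" by blast
    then have c: "card (I - {i}) \<le> ?c i" using IH[of i] exc0 by blast
    \<comment> \<open>The bound \<open>2 * card (I - {i}) + 1 <= card I + 1\<close> leaves only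
      dimension 2, which is refuted by counting in the other direction \<open>j\<close>.\<close>
    then have "card (I - {i}) = 1" using sum[OF i(1)] i(2) assms(5,7) cI[OF i(1)] by linarith
    then obtain j where j: "I - {i} = {j}" by (auto simp: card_1_singleton_iff)
    then have I: "I = {i, j}" "i \<noteq> j" using i(1) by auto
    have "card (bad {j} k (?P i) j) \<ge> 1" using c j by simp
    then have "bad {j} k (?P i) j \<noteq> {}" by (metis card.empty not_one_le_zero)
    then obtain v w' where b: "(v, w') \<in> bad {j} k (?P i) j" by (metis ex_in_conv surj_pair)
    then have "even (sum w' {j})" using step_parity[of "{j}" j v w'] by (simp add: mem_bad)
    then have "exc (I - {j}) (?P j) \<le> - 2"
      using proj_two_dim_exc[OF I assms(3)[OF i(1)] assms(2)[OF i(1)] _ assms(4) w, of w'] b j assms(2)[of j]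
        I by (simp add: mem_bad)
    then show False using exc[of j] assms(6,7) i(2) I by simp
  qed
  obtain u where u: "u \<in> X" "odd (sum u I)" using exc_ge1_odd[OF finX assms(6)] by blast
  obtain l where l: "l \<in> I" "?P l \<noteq> {}"
    using all_coords_even[of I u] proj_empty_odd[where k = k, OF assms(1) _ assms(4) _ u(1)] assms(1) u(2)
    by blast
  have "?e l \<noteq> 1" using P0 l by blast
  then have el: "?e l \<ge> 2" using e1[OF l(1)] by linarith
  have split: "sum ?e I = ?e l + sum ?e (I - {l})" by (rule sum.remove[OF assms(1) l(1)])
  have others: "?e i = 1" if "i \<in> I - {l}" for i
    by (rule sum_eq_ones[of "I - {l}"]) (use assms(1,7) that e1 split el cI[OF l(1)] in auto)
  have "card (I - {l}) \<le> sum ?e (I - {l})" by (rule sum_ge_card) (use e1 in auto)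
  then have el2: "?e l \<le> 2" using split assms(7) cI[OF l(1)] by linarith
  have "I - {l} \<noteq> {}" using cI[OF l(1)] assms(5) by (metis One_nat_def Suc_1 card.empty not_less_eq_eq le0 order_refl)
  then obtain i where i: "i \<in> I" "i \<noteq> l" by blast
  let ?S = "{u \<in> X. odd (sum u I)}"
  \<comment> \<open>If \<open>u l\<close> were even, omitting any one coordinate would leave an odd
    sum: for \<open>l\<close> by this evenness, for any other because its projection is
    empty.\<close>
  have odd_l: "odd (u l)" if "u \<in> ?S" for u
  proof (rule ccontr)
    assume "\<not> odd (u l)"
    moreover have "sum u I = sum u (I - {l}) + u l" using sum.remove[OF assms(1) l(1), of u] by simp
    ultimately have "odd (sum u (I - {j}))" if "j \<in> I" for j
      using proj_empty_odd[where k = k, OF assms(1) _ assms(4) P0, of j u] others[of j] \<open>u \<in> ?S\<close> that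
      by (cases "j = l") auto
    then show False using all_coords_even[of I u] assms(1) that by blast
  qed
  have "2 * card ?S \<le> ?e l"
  proof (rule bad_ge2[where k = k and S = ?S, OF assms(1) l(1) assms(3)[OF l(1)] assms(4) subset_refl])
    show "odd (u l)" if "u \<in> ?S" for u using odd_l[OF that] .
  next
    fix u v assume "u \<in> ?S" "step l u v"
    then show "v \<notin> X"
      using proj_empty_nbr[where k = k, OF assms(1) i(1) assms(4) P0[OF i(1)] l(1), of u v] others[of i] i by simp
  qed
  then have "card ?S \<le> 1" using el2 by linarith
  then show ?thesis by (rule exc_eq_singleton[OF finX assms(6)])
qed

section \<open>Boxes with an even side\<close>

text \<open>By \<open>exc_even\<close>, a direction without bad edges has an odd side. Dropping it
  keeps an even side, so induction applies to the projection, and doubling its bad edges gives at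
  least \<open>card I\<close>, the dimension being at least 2.\<close>

lemma even_box_bad:
  assumes "finite I" "\<And>i. i \<in> I \<Longrightarrow> k i \<ge> 2" "\<exists>i\<in>I. even (k i)" "X \<subseteq> box I k" "exc I X \<ge> 1"
  shows "card I \<le> (\<Sum>j\<in>I. card (bad I k X j))"
  using assms
proof (induction I arbitrary: X rule: finite_psubset_induct)
  case (psubset I)
  let ?e = "\<lambda>j. card (bad I k X j)"
  show ?case
  proof (rule ccontr)
    assume c: "\<not> ?thesis"
    then obtain i where i: "i \<in> I" "?e i = 0" using sum_ge_card[of I ?e] by force
    have "odd (k i)"
    proof
      assume "even (k i)"
      then show False using exc_even[where k = k, OF psubset.hyps i(1) psubset.prems(3)] i(2) psubset.prems(4) by simp
    qed
    then obtain l where l: "l \<in> I - {i}" "even (k l)" using psubset.prems(2) by auto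
    have "exc (I - {i}) (proj I k i X) \<ge> 1"
      using exc_odd[where k = k, OF psubset.hyps i(1) psubset.prems(3) \<open>odd (k i)\<close>] i(2) psubset.prems(4) by simp
    then have "card (I - {i}) \<le> (\<Sum>j\<in>I - {i}. card (bad (I - {i}) k (proj I k i X) j))"
      by (intro psubset.IH) (use i l psubset.prems(1) proj_subset[of I k i X] in auto)
    moreover have "card I = Suc (card (I - {i}))" by (rule card.remove[OF psubset.hyps i(1)])
    moreover have "card (I - {i}) \<noteq> 0" using l psubset.hyps by auto
    ultimately show False
      using bad_proj_sum[where k = k, OF psubset.hyps i(1) \<open>odd (k i)\<close> psubset.prems(1)[OF i(1)], of X] c
      by linarith
  qed
qed

section \<open>Excess of a full box and of complements\<close>

lemma exc_box:
  assumes "finite I"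
  shows "exc I (box I k) = (if \<forall>i\<in>I. odd (k i) then - 1 else 0)"
proof -
  \<comment> \<open>The sign is minus a product over the coordinates, so the sum over the box
    factors into alternating sums along the sides: 1 for an odd side, 0 for an even one.\<close>
  have psign: "psign (sum u I) = - (\<Prod>i\<in>I. (- 1) ^ u i)" for u :: "'a \<Rightarrow> nat"
    by (simp add: psign_def power_sum[symmetric])
  have alt: "(\<Sum>x<m. (- 1) ^ x) = (if odd m then 1 else 0 :: int)" for m
    by (induction m) auto
  have "exc I (box I k) = - (\<Sum>u\<in>box I k. \<Prod>i\<in>I. (- 1) ^ u i)"
    by (simp add: exc_def psign sum_negf)
  also have "(\<Sum>u\<in>box I k. \<Prod>i\<in>I. (- 1) ^ u i) = (\<Prod>i\<in>I. \<Sum>x<k i. (- 1) ^ x :: int)"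
    unfolding box_def by (rule prod_sum_PiE[symmetric]) (use assms in auto)
  also have "\<dots> = (if \<forall>i\<in>I. odd (k i) then 1 else 0)"
    unfolding alt using assms by auto
  finally show ?thesis by simp
qed

lemma exc_Diff:
  assumes "finite Y" "X \<subseteq> Y" shows "exc I (Y - X) = exc I Y - exc I X"
  unfolding exc_def using assms by (rule sum_diff)

text \<open>Equality makes every line in the even direction \<open>i\<close> tight, so boundary
  edges in the projected box give bad edges. The isoperimetric bound then leaves two dual cases: a
  single odd vertex, or all but a single even vertex.\<close>

lemma even_box_bad_eq:
  assumes fin: "finite I" and k2: "\<And>i. i \<in> I \<Longrightarrow> k i \<ge> 2" and i: "i \<in> I" "even (k i)"
    and X: "X \<subseteq> box I k" and exc: "exc I X \<ge> 1"
    and c: "(\<Sum>j\<in>I. card (bad I k X j)) \<le> card I" and I3: "card I \<ge> 3"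
  shows "(\<exists>u. X = {u} \<and> odd (sum u I)) \<or> (\<exists>a\<in>box I k. X = box I k - {a} \<and> even (sum a I))"
proof -
  let ?e = "\<lambda>j. card (bad I k X j)"
  let ?I = "I - {i}"
  let ?B = "box ?I k"
  have finX: "finite X" using X finite_box[OF fin] by (rule finite_subset)
  have cI: "card I = Suc (card (I - {j}))" if "j \<in> I" for j
    using card.remove[OF fin that] .
  \<comment> \<open>On an odd side, a projection of positive excess would give at least
    \<open>2 * (card I - 1)\<close> bad edges, more than \<open>card I\<close> in dimension at least
    3.\<close>
  have ge1: "?e j \<ge> 1" if j: "j \<in> I" for j
  proof (cases "even (k j)")
    case True
    then show ?thesis using exc_even[where k = k, OF fin j X] exc by simp
  next
    case False
    have "\<not> exc (I - {j}) (proj I k j X) \<ge> 1"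
    proof
      assume "exc (I - {j}) (proj I k j X) \<ge> 1"
      then have "card (I - {j}) \<le> (\<Sum>l\<in>I - {j}. card (bad (I - {j}) k (proj I k j X) l))"
        by (intro even_box_bad) (use fin k2 i False proj_subset[of I k j X] in auto)
      then show False
        using bad_proj_sum[where k = k, OF fin j False k2[OF j], of X] c I3 cI[OF j] by linarith
    qed
    then show ?thesis using exc_odd[where k = k, OF fin j X False] exc by linarith
  qed
  have e1: "?e j = 1" if "j \<in> I" for j by (rule sum_eq_ones[OF fin ge1 c that])
  have exc1: "exc I X = 1" using exc_even[where k = k, OF fin i(1) X i(2)] exc e1[OF i(1)] by simp
  txt \<open>Let Z be the lines in direction i meeting X and W those contained in X. As X contains the odd
    end of every line in Z and misses the even end of every line outside W, each adjacent pair
    (w, w') in Q j lies below a bad edge in direction j, at the odd end of w.\<close>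
  define Z where "Z = {w \<in> ?B. line i w X \<inter> {..<k i} \<noteq> {}}"
  define W where "W = {w \<in> ?B. {..<k i} \<subseteq> line i w X}"
  have ki: "k i \<ge> 2" using k2 i(1) .
  have WZ: "W \<subseteq> Z"
  proof
    fix w assume w: "w \<in> W"
    then have "0 \<in> line i w X \<inter> {..<k i}" using ki unfolding W_def by auto
    then show "w \<in> Z" using w unfolding W_def Z_def by blast
  qed
  note tight = exc_even_tight[where k = k, OF fin i(1) X i(2)]
  have exc_e: "exc I X = int (?e i)" using exc1 e1[OF i(1)] by simp
  define Q where "Q j = {(w, w'). w \<in> Z \<and> w' \<in> ?B - W \<and> step j w w'}" for j
  have finQ: "finite (Q j)" for j
    by (rule finite_subset[of _ "?B \<times> ?B"]) (auto simp: Q_def Z_def fin)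
  have Q1: "card (Q j) \<le> 1" if j: "j \<in> ?I" for j
  proof -
    \<comment> \<open>The position of the odd end of the line \<open>w\<close>; on an adjacent line,
      which has the opposite parity, it is the even end.\<close>
    let ?x = "\<lambda>w. if odd (sum w ?I) then 0 else k i - 1"
    let ?f = "\<lambda>(w, w'). (w(i := ?x w), w'(i := ?x w))"
    have "?f (w, w') \<in> bad I k X j" if q: "(w, w') \<in> Q j" for w w'
    proof -
      have w: "w \<in> ?B" "w' \<in> ?B" "step j w w'" "line i w X \<inter> {..<k i} \<noteq> {}" "\<not> {..<k i} \<subseteq> line i w' X"
        using q unfolding Q_def Z_def W_def by blast+
      have par: "odd (sum w' ?I) \<longleftrightarrow> even (sum w ?I)" using step_parity[of ?I j w w'] fin j w(3) by simp
      have "w(i := ?x w) \<in> X" using tight(1)[OF exc_e w(1,4)] .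
      moreover have "w'(i := ?x w) \<notin> X" using tight(2)[OF exc_e w(2,5)] par by (cases "odd (sum w ?I)") simp_all
      moreover have "?x w < k i" using ki by simp
      moreover have "odd (sum w ?I + ?x w)" using i(2) ki by simp
      ultimately show ?thesis
        using box_upd[OF w(1) i(1), of "?x w"] box_upd[OF w(2) i(1), of "?x w"] step_upd[OF w(3), of i "?x w"] j
        unfolding case_prod_conv mem_bad sum_upd[OF fin i(1)] by blast
    qed
    then have "?f ` Q j \<subseteq> bad I k X j" by (intro image_subsetI) auto
    moreover have "inj_on ?f (Q j)"
    proof (rule inj_onI)
      fix p q assume pq: "p \<in> Q j" "q \<in> Q j" "?f p = ?f q"
      obtain w w' v v' where e: "p = (w, w')" "q = (v, v')" by fastforce
      then have "w \<in> ?B" "w' \<in> ?B" "v \<in> ?B" "v' \<in> ?B" using pq by (auto simp: Q_def Z_def)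
      moreover have "w(i := ?x w) = v(i := ?x v)" "w'(i := ?x w) = v'(i := ?x v)" using pq(3) e by simp_all
      ultimately show "p = q" using e upd_inj[of w I i k v] upd_inj[of w' I i k v'] by simp
    qed
    ultimately have "card (Q j) \<le> ?e j" using card_inj_on_le[OF _ _ finite_bad[OF fin]] by blast
    then show ?thesis using e1 j by simp
  qed
  have Q_eq: "p = q" if "j \<in> ?I" "p \<in> Q j" "q \<in> Q j" for j p q
    using Q1[OF that(1)] that(2,3) finQ[of j] by (metis card_le_Suc0_iff_eq One_nat_def)
  have "bad I k X i \<noteq> {}" using e1[OF i(1)] by (metis card.empty zero_neq_one)
  then obtain u v where uv: "(u, v) \<in> bad I k X i" by (metis ex_in_conv surj_pair)
  \<comment> \<open>The line carrying the only bad edge in direction \<open>i\<close>; it has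
    vertices inside and outside \<open>X\<close>.\<close>
  define w0 where "w0 = u(i := undefined)"
  have w0: "w0 \<in> Z" "w0 \<in> ?B - W"
  proof -
    have uv': "u \<in> box I k" "v \<in> box I k" "u \<in> X" "v \<notin> X" "step i u v" using uv by (simp_all add: mem_bad)
    have b: "w0 \<in> ?B" unfolding w0_def using box_drop[OF uv'(1)] .
    have "u i \<in> line i w0 X" "v i \<notin> line i w0 X" unfolding line_def w0_def mem_Collect_eq fun_upd_upd
      using step_eq[OF uv'(5)] uv'(3,4) by simp_all
    moreover have "u i < k i" "v i < k i" using box_less[OF uv'(1) i(1)] box_less[OF uv'(2) i(1)] .
    ultimately show "w0 \<in> Z" "w0 \<in> ?B - W" using b unfolding Z_def W_def by auto
  qed
  \<comment> \<open>A neighbour of \<open>w0\<close> in \<open>W\<close> also lies in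
    \<open>Z\<close> and can come first; any other neighbour can come second.\<close>
  have Q0: "\<exists>w. (w0, w) \<in> Q j \<or> (w, w0) \<in> Q j" if j: "j \<in> ?I" for j
  proof -
    obtain w where w: "w \<in> ?B" "step j w0 w"
      using ex_step[of w0 ?I k j] w0(2) j k2[of j] by blast
    show ?thesis
    proof (cases "w \<in> W")
      case True
      then have "(w, w0) \<in> Q j" using WZ w0 step_sym[OF w(2)] unfolding Q_def by blast
      then show ?thesis by blast
    next
      case False
      then have "(w0, w) \<in> Q j" using w0 w unfolding Q_def by blast
      then show ?thesis by blast
    qed
  qed
  \<comment> \<open>\<open>bnd_card_ge\<close> demands \<open>card ?I\<close> boundary edges in all,
    while each direction \<open>l\<close> offers at most the one pair of \<open>Q l\<close>. So
    every direction is exhausted.\<close>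
  have bnd_eq: "Q j \<subseteq> bnd ?I k Y j"
    if Y: "Y = W \<or> Y = Z" and "Y \<noteq> {}" "Y \<noteq> ?B" and j: "j \<in> ?I" for Y j
  proof -
    have YB: "Y \<subseteq> ?B" using Y unfolding W_def Z_def by blast
    have sub: "bnd ?I k Y l \<subseteq> Q l" for l
      using Y WZ unfolding bnd_def Q_def by auto
    have le: "card (bnd ?I k Y l) \<le> 1" if "l \<in> ?I" for l
      using card_mono[OF finQ sub, of l] Q1[OF that] by linarith
    have "card ?I \<le> (\<Sum>l\<in>?I. card (bnd ?I k Y l))"
      by (rule bnd_card_ge) (use fin k2 YB that in auto)
    also have "\<dots> = card (bnd ?I k Y j) + (\<Sum>l\<in>?I - {j}. card (bnd ?I k Y l))"
      by (rule sum.remove) (use fin j in auto)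
    also have "(\<Sum>l\<in>?I - {j}. card (bnd ?I k Y l)) \<le> card (?I - {j})"
      using sum_bounded_above[of "?I - {j}" "\<lambda>l. card (bnd ?I k Y l)" 1] le by simp
    also have "card ?I = Suc (card (?I - {j}))" by (rule card.remove) (use fin j in auto)
    finally have "card (bnd ?I k Y j) \<ge> card (Q j)" using Q1[OF j] by linarith
    then have "bnd ?I k Y j = Q j" using card_seteq[OF finQ sub, of j] by simp
    then show ?thesis by simp
  qed
  have "?I \<noteq> {}" using cI[OF i(1)] I3 by (metis card.empty One_nat_def not_less_eq_eq numeral_3_eq_3 Suc_leD le_refl)
  then obtain j where j: "j \<in> ?I" by blast
  txt \<open>Otherwise both the boundary of W and that of Z exhaust Q j, but w0 lies in Z and not in W.\<close>
  have "W = {} \<or> Z = ?B"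
  proof (rule ccontr)
    assume "\<not> ?thesis"
    then have "Q j \<subseteq> bnd ?I k W j" "Q j \<subseteq> bnd ?I k Z j"
      using bnd_eq[of W j] bnd_eq[of Z j] j w0 by blast+
    then show False using Q0[OF j] w0 unfolding bnd_def by blast
  qed
  moreover have mem: "x(i := undefined) \<in> ?B" "x \<in> X \<Longrightarrow> x(i := undefined) \<in> Z" "x \<notin> X \<Longrightarrow> x(i := undefined) \<notin> W"
    if x: "x \<in> box I k" for x
  proof -
    have m: "x i < k i" "x i \<in> line i (x(i := undefined)) X \<longleftrightarrow> x \<in> X"
      using x i(1) box_less[of x I k i] unfolding line_def by simp_all
    show B: "x(i := undefined) \<in> ?B" using box_drop[OF x] .
    show "x(i := undefined) \<in> Z" if "x \<in> X" using B m that unfolding Z_def by blast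
    show "x(i := undefined) \<notin> W" if "x \<notin> X" using m that unfolding W_def by blast
  qed
  have stepB: "step j (x(i := undefined)) (y(i := undefined))" if "step j x y" for x y
    using step_upd[OF that] j by blast
  have card_bad: "?e j = 1" using e1 j by blast
  ultimately consider "W = {}" | "Z = ?B" by blast
  then show ?thesis
  proof cases
    case 1
    let ?S = "{u \<in> X. odd (sum u I)}"
    \<comment> \<open>No line lies inside \<open>X\<close>. Two members of \<open>X\<close> adjacent
      in direction \<open>j\<close> would put their lines into \<open>Q j\<close> in both orders,
      against uniqueness; so each odd vertex of \<open>X\<close> has a bad edge in direction
      \<open>j\<close>.\<close>
    have "card ?S \<le> ?e j"
    proof (rule bad_ge[OF fin _ _ X])
      fix x y assume x: "x \<in> ?S" and y: "y \<in> box I k" "step j x y"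
      show "y \<notin> X"
      proof
        assume yX: "y \<in> X"
        let ?x = "x(i := undefined)" and ?y = "y(i := undefined)"
        have xB: "x \<in> box I k" "x \<in> X" using x X by blast+
        have "(?x, ?y) \<in> Q j" "(?y, ?x) \<in> Q j"
          using mem(1,2)[OF xB(1)] mem(1,2)[OF y(1)] xB(2) yX stepB[OF y(2)] step_sym[OF stepB[OF y(2)]] 1
          unfolding Q_def by blast+
        then have "(?x, ?y) = (?y, ?x)" using Q_eq[OF j] by blast
        then have "?x = ?y" by (rule Pair_inject)
        then show False using stepB[OF y(2)] step_irrefl[of j ?y] by simp
      qed
    qed (use j k2 in auto)
    then have "card ?S \<le> 1" using card_bad by simp
    then show ?thesis using exc_eq_singleton[OF finX exc] by blast
  next
    case 2
    \<comment> \<open>The dual case: every line meets \<open>X\<close>, so no two vertices of the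
      complement are adjacent in direction \<open>j\<close>, and each even one ends a bad edge
      there. Excess -1 then leaves one even vertex and no odd one.\<close>
    let ?C = "box I k - X"
    have finC: "finite ?C" using fin by simp
    let ?A = "{v \<in> ?C. even (sum v I)}"
    have nbr: "y \<in> X" if x: "x \<in> ?C" and y: "y \<in> box I k" "step j x y" for x y
    proof (rule ccontr)
      assume yX: "y \<notin> X"
      let ?x = "x(i := undefined)" and ?y = "y(i := undefined)"
      have xB: "x \<in> box I k" "x \<notin> X" using x by blast+
      have "(?x, ?y) \<in> Q j" "(?y, ?x) \<in> Q j"
        using mem(1,3)[OF xB(1)] mem(1,3)[OF y(1)] xB(2) yX stepB[OF y(2)] step_sym[OF stepB[OF y(2)]] 2
        unfolding Q_def by blast+
      then have "(?x, ?y) = (?y, ?x)" using Q_eq[OF j] by blast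
      then have "?x = ?y" by (rule Pair_inject)
      then show False using stepB[OF y(2)] step_irrefl[of j ?y] by simp
    qed
    have "\<exists>y. y \<in> box I k \<and> step j x y" if "x \<in> ?A" for x
      using ex_step[of x I k j] j k2 that by blast
    then obtain f where f: "\<And>x. x \<in> ?A \<Longrightarrow> f x \<in> box I k \<and> step j x (f x)" by metis
    have "(\<lambda>x. (f x, x)) ` ?A \<subseteq> bad I k X j"
    proof (rule image_subsetI)
      fix x assume x: "x \<in> ?A"
      then have "odd (sum (f x) I)" using step_parity[OF fin _ conjunct2[OF f[OF x]]] j by blast
      then show "(f x, x) \<in> bad I k X j"
        using x f[OF x] nbr[of x "f x"] step_sym[of j x "f x"] unfolding mem_bad by blast
    qed
    moreover have "inj_on (\<lambda>x. (f x, x)) ?A" by (auto simp: inj_on_def)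
    ultimately have "card ?A \<le> ?e j"
      using card_inj_on_le[OF _ _ finite_bad[OF fin]] by blast
    then have "card ?A \<le> 1" using card_bad by simp
    moreover have "exc I (box I k) = 0" using i unfolding exc_box[OF fin] by auto
    then have "exc I ?C = - 1" using exc_Diff[OF finite_box[OF fin] X, of I] exc1 by simp
    then have "int (card {v \<in> ?C. odd (sum v I)}) - int (card ?A) = - 1" using exc_card[OF finC, of I] by simp
    ultimately have A: "card ?A = 1" and O: "card {v \<in> ?C. odd (sum v I)} = 0" by linarith+
    obtain a where "?A = {a}" using card_1_singletonE[OF A] .
    moreover have "finite {v \<in> ?C. odd (sum v I)}" by (rule finite_subset[OF _ finC]) blast
    then have "{v \<in> ?C. odd (sum v I)} = {}" using O by simp
    ultimately have "?C = {a}" "even (sum a I)" by blast+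
    then have "X = box I k - {a}" "a \<in> box I k" using X by blast+
    then show ?thesis using \<open>even (sum a I)\<close> by blast
  qed
qed

section \<open>Matching preclusion in grids\<close>

lemma hall:
  assumes "finite B" "\<And>b. b \<in> B \<Longrightarrow> finite (N b)"
    and "\<And>S. S \<subseteq> B \<Longrightarrow> card S \<le> card (\<Union>(N ` S))"
  shows "\<exists>f. inj_on f B \<and> (\<forall>b\<in>B. f b \<in> N b)"
  using assms
proof (induction B arbitrary: N rule: finite_psubset_induct)
  case (psubset B)
  note hall = psubset.prems(2)
  show ?case
  proof (cases "\<exists>S. S \<subset> B \<and> S \<noteq> {} \<and> card (\<Union>(N ` S)) = card S")
    case True
    then obtain S where S: "S \<subset> B" "S \<noteq> {}" "card (\<Union>(N ` S)) = card S" by blast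
    have finS: "finite S" using S(1) psubset.hyps finite_subset by blast
    have "\<exists>f. inj_on f S \<and> (\<forall>b\<in>S. f b \<in> N b)"
    proof (rule psubset.IH[OF S(1)])
      show "finite (N b)" if "b \<in> S" for b using psubset.prems(1) that S(1) by blast
      show "card T \<le> card (\<Union>(N ` T))" if "T \<subseteq> S" for T using hall that S(1) by blast
    qed
    then obtain f where f: "inj_on f S" "\<forall>b\<in>S. f b \<in> N b" by blast
    \<comment> \<open>\<open>S\<close> uses up all its neighbours, so the other members must avoid
      them. Hall's condition survives: apply it to \<open>T \<union> S\<close> and subtract the
      equality for \<open>S\<close>.\<close>
    let ?N = "\<lambda>b. N b - \<Union>(N ` S)"
    have "\<exists>g. inj_on g (B - S) \<and> (\<forall>b\<in>B - S. g b \<in> ?N b)"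
    proof (rule psubset.IH)
      show "B - S \<subset> B" using S by blast
      show "finite (?N b)" if "b \<in> B - S" for b using psubset.prems(1) that by blast
      show "card T \<le> card (\<Union>(?N ` T))" if T: "T \<subseteq> B - S" for T
      proof -
        have "card (T \<union> S) \<le> card (\<Union>(N ` (T \<union> S)))" using T S(1) by (intro hall) blast
        moreover have "\<Union>(N ` (T \<union> S)) = \<Union>(?N ` T) \<union> \<Union>(N ` S)" by blast
        moreover have "card (\<Union>(?N ` T) \<union> \<Union>(N ` S)) \<le> card (\<Union>(?N ` T)) + card (\<Union>(N ` S))"
          by (rule card_Un_le)
        moreover have "card (T \<union> S) = card T + card S"
          using T finS finite_subset[OF T] psubset.hyps by (intro card_Un_disjoint) auto
        ultimately show ?thesis using S(3) by simp
      qed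
    qed
    then obtain g where g: "inj_on g (B - S)" "\<forall>b\<in>B - S. g b \<in> ?N b" by blast
    let ?h = "\<lambda>b. if b \<in> S then f b else g b"
    have "inj_on ?h B"
    proof (rule inj_onI)
      fix x y assume xy: "x \<in> B" "y \<in> B" "?h x = ?h y"
      consider "x \<in> S" "y \<in> S" | "x \<notin> S" "y \<notin> S" | "x \<in> S" "y \<notin> S" | "x \<notin> S" "y \<in> S" by blast
      then show "x = y"
      proof cases
        case 1
        then show ?thesis using f(1) xy(3) by (simp add: inj_on_eq_iff)
      next
        case 2
        then show ?thesis using g(1) xy by (simp add: inj_on_eq_iff)
      next
        case 3
        then have "f x = g y" using xy(3) by simp
        moreover have "f x \<in> N x" "g y \<in> ?N y" using 3 f(2) g(2) xy(2) by blast+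
        ultimately show ?thesis using 3 by auto
      next
        case 4
        then have "g x = f y" using xy(3) by simp
        moreover have "f y \<in> N y" "g x \<in> ?N x" using 4 f(2) g(2) xy(1) by blast+
        ultimately show ?thesis using 4 by auto
      qed
    qed
    moreover have "\<forall>b\<in>B. ?h b \<in> N b" using f(2) g(2) by auto
    ultimately show ?thesis by blast
  next
    case False
    show ?thesis
    proof (cases "B = {}")
      case True
      then show ?thesis by simp
    next
      case ne: False
      then obtain b where b: "b \<in> B" by blast
      have "card {b} \<le> card (N b)" using hall[of "{b}"] b by simp
      then have "N b \<noteq> {}" by auto
      then obtain a where a: "a \<in> N b" by blast
      \<comment> \<open>Every nonempty proper subset has a neighbour to spare, so \<open>b\<close>
        may take an arbitrary partner \<open>a\<close>.\<close>
      let ?N = "\<lambda>x. N x - {a}"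
      have "\<exists>g. inj_on g (B - {b}) \<and> (\<forall>x\<in>B - {b}. g x \<in> ?N x)"
      proof (rule psubset.IH)
        show "B - {b} \<subset> B" using b by blast
        show "finite (?N x)" if "x \<in> B - {b}" for x using psubset.prems(1) that by blast
        show "card T \<le> card (\<Union>(?N ` T))" if T: "T \<subseteq> B - {b}" for T
        proof (cases "T = {}")
          case False
          have "T \<subset> B" using T b by blast
          then have "card T \<le> card (\<Union>(N ` T))" "card (\<Union>(N ` T)) \<noteq> card T"
            using hall[of T] False \<open>\<not> (\<exists>S. S \<subset> B \<and> S \<noteq> {} \<and> card (\<Union>(N ` S)) = card S)\<close> by blast+
          moreover have "\<Union>(?N ` T) = \<Union>(N ` T) - {a}" by blast
          moreover have "card (\<Union>(N ` T)) - 1 \<le> card (\<Union>(N ` T) - {a})" using diff_card_le_card_Diff[of "{a}" "\<Union>(N ` T)"] by simp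
          ultimately show ?thesis by simp
        qed simp
      qed
      then obtain g where g: "inj_on g (B - {b})" "\<forall>x\<in>B - {b}. g x \<in> ?N x" by blast
      have "inj_on (g(b := a)) B"
      proof (rule inj_onI)
        fix x y assume xy: "x \<in> B" "y \<in> B" "(g(b := a)) x = (g(b := a)) y"
        have neq: "g z \<noteq> a" if "z \<in> B" "z \<noteq> b" for z using g(2) that by blast
        show "x = y"
          using xy neq[of x] neq[of y] inj_onD[OF g(1), of x y] by (cases "x = b"; cases "y = b") auto
      qed
      moreover have "\<forall>x\<in>B. (g(b := a)) x \<in> N x" using g(2) a by auto
      ultimately show ?thesis by blast
    qed
  qed
qed

section \<open>Bad pairs as edges of the grid graph\<close>

definition bad_edges :: "'i set \<Rightarrow> ('i \<Rightarrow> nat) \<Rightarrow> ('i \<Rightarrow> nat) set \<Rightarrow> ('i \<Rightarrow> nat) set set" where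
  "bad_edges I k X = (\<lambda>(u, v). {u, v}) ` (\<Union>i\<in>I. bad I k X i)"

lemma mem_bad_edges: "e \<in> bad_edges I k X \<longleftrightarrow> (\<exists>i\<in>I. \<exists>u v. e = {u, v} \<and> (u, v) \<in> bad I k X i)"
  unfolding bad_edges_def by auto

text \<open>Exactly one end of a bad edge lies in \<open>X\<close>, which recovers the order of the
  pair; its direction is determined too, so the union is disjoint.\<close>

lemma card_bad_edges:
  assumes "finite I" shows "card (bad_edges I k X) = (\<Sum>i\<in>I. card (bad I k X i))"
proof -
  have "inj_on (\<lambda>(u, v). {u, v}) (\<Union>i\<in>I. bad I k X i)"
  proof (rule inj_onI)
    fix p q assume "p \<in> (\<Union>i\<in>I. bad I k X i)" "q \<in> (\<Union>i\<in>I. bad I k X i)"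
      and eq: "(case p of (u, v) \<Rightarrow> {u, v}) = (case q of (u, v) \<Rightarrow> {u, v})"
    then obtain i j u v u' v' where pq: "p = (u, v)" "q = (u', v')"
      and "(u, v) \<in> bad I k X i" "(u', v') \<in> bad I k X j"
      by (metis UN_E surj_pair)
    then have "u \<in> X" "u' \<in> X" "v \<notin> X" "v' \<notin> X" by (simp_all add: mem_bad)
    then show "p = q" using eq pq by (auto simp: doubleton_eq_iff)
  qed
  then have "card (bad_edges I k X) = card (\<Union>i\<in>I. bad I k X i)"
    unfolding bad_edges_def by (rule card_image)
  also have "\<dots> = (\<Sum>i\<in>I. card (bad I k X i))"
  proof (rule card_UN_disjoint)
    show "\<forall>i\<in>I. \<forall>j\<in>I. i \<noteq> j \<longrightarrow> bad I k X i \<inter> bad I k X j = {}"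
    proof (intro ballI impI)
      fix i j assume "i \<in> I" "j \<in> I" "i \<noteq> j"
      then have "\<not> ((u, v) \<in> bad I k X i \<and> (u, v) \<in> bad I k X j)" for u v
        using step_dir_unique[of i u v j] by (auto simp: mem_bad)
      then show "bad I k X i \<inter> bad I k X j = {}" by auto
    qed
  qed (use assms in simp_all)
  finally show ?thesis .
qed

lemma verts_grid: "verts (grid n k) = box {..<n} k"
  by (simp add: grid_def box_def Let_def)

lemma grid_adj_iff_step:
  assumes "u \<in> box {..<n} k" "v \<in> box {..<n} k"
  shows "grid_adj n u v \<longleftrightarrow> (\<exists>i\<in>{..<n}. step i u v)"
proof -
  have "u j = v j" if "\<not> j < n" for j
    using that box_undefined[OF assms(1), of j] box_undefined[OF assms(2), of j] by simp
  then have "(\<forall>j<n. j \<noteq> i \<longrightarrow> u j = v j) \<longleftrightarrow> (\<forall>j. j \<noteq> i \<longrightarrow> u j = v j)" for i by blast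
  then show ?thesis unfolding grid_adj_def step_def by auto
qed

lemma mem_edges_grid:
  "e \<in> edges (grid n k) \<longleftrightarrow>
     (\<exists>i\<in>{..<n}. \<exists>u v. e = {u, v} \<and> u \<in> box {..<n} k \<and> v \<in> box {..<n} k \<and> step i u v \<and> odd (sum u {..<n}))"
proof
  assume "e \<in> edges (grid n k)"
  then obtain u v where e: "e = {u, v}" and uv: "u \<in> box {..<n} k" "v \<in> box {..<n} k" "grid_adj n u v"
    unfolding grid_def box_def Let_def by auto
  then obtain i where i: "i \<in> {..<n}" "step i u v" using grid_adj_iff_step by blast
  have "e = {v, u}" using e by blast
  moreover have "odd (sum u {..<n}) \<or> odd (sum v {..<n})" using step_parity[of "{..<n}" i u v] i by auto
  ultimately show "\<exists>i\<in>{..<n}. \<exists>u v. e = {u, v} \<and> u \<in> box {..<n} k \<and> v \<in> box {..<n} k \<and> step i u v \<and> odd (sum u {..<n})"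
    using e uv i step_sym[OF i(2)] by blast
next
  assume "\<exists>i\<in>{..<n}. \<exists>u v. e = {u, v} \<and> u \<in> box {..<n} k \<and> v \<in> box {..<n} k \<and> step i u v \<and> odd (sum u {..<n})"
  then obtain i u v where "i \<in> {..<n}" "e = {u, v}" "u \<in> box {..<n} k" "v \<in> box {..<n} k" "step i u v" by blast
  moreover from this have "grid_adj n u v" using grid_adj_iff_step by blast
  ultimately show "e \<in> edges (grid n k)" unfolding grid_def box_def Let_def by auto
qed

lemma finite_edges_grid: "finite (edges (grid n k))"
  by (rule finite_subset[of _ "Pow (box {..<n} k)"]) (auto simp: mem_edges_grid)

lemma incident_odd:
  assumes "u \<in> box {..<n} k" "odd (sum u {..<n})"
  shows "incident_edges (grid n k) u = bad_edges {..<n} k {u}"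
proof (intro equalityI subsetI)
  fix e assume "e \<in> incident_edges (grid n k) u"
  then obtain i x y where i: "i \<in> {..<n}" "u \<in> e" "e = {x, y}" "x \<in> box {..<n} k" "y \<in> box {..<n} k" "step i x y"
    "odd (sum x {..<n})"
    unfolding incident_edges_def mem_edges_grid by blast
  then have "even (sum y {..<n})" using step_parity[of "{..<n}" i x y] by simp
  then have "u \<noteq> y" using assms(2) by blast
  then have "u = x" using i by blast
  then have "(x, y) \<in> bad {..<n} k {u} i" using i \<open>u \<noteq> y\<close> unfolding mem_bad by blast
  then show "e \<in> bad_edges {..<n} k {u}" using i unfolding mem_bad_edges by blast
next
  fix e assume "e \<in> bad_edges {..<n} k {u}"
  then show "e \<in> incident_edges (grid n k) u"
    unfolding incident_edges_def mem_edges_grid mem_bad_edges mem_bad by blast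
qed

text \<open>Bad pairs run from odd to even vertices, so an even centre has to be the one vertex
  missing from the set.\<close>

lemma incident_even:
  assumes "a \<in> box {..<n} k" "even (sum a {..<n})"
  shows "incident_edges (grid n k) a = bad_edges {..<n} k (box {..<n} k - {a})"
proof (intro equalityI subsetI)
  fix e assume "e \<in> incident_edges (grid n k) a"
  then obtain i x y where i: "i \<in> {..<n}" "a \<in> e" "e = {x, y}" "x \<in> box {..<n} k" "y \<in> box {..<n} k" "step i x y"
    "odd (sum x {..<n})"
    unfolding incident_edges_def mem_edges_grid by blast
  then have "a \<noteq> x" using assms(2) by blast
  then have "a = y" using i by blast
  then have "(x, y) \<in> bad {..<n} k (box {..<n} k - {a}) i" using i \<open>a \<noteq> x\<close> unfolding mem_bad by blast
  then show "e \<in> bad_edges {..<n} k (box {..<n} k - {a})" using i unfolding mem_bad_edges by blast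
next
  fix e assume "e \<in> bad_edges {..<n} k (box {..<n} k - {a})"
  then show "e \<in> incident_edges (grid n k) a"
    unfolding incident_edges_def mem_edges_grid mem_bad_edges mem_bad by blast
qed

text \<open>Each edge joins vertices of opposite sign, and the edges of a matching are
  disjoint.\<close>

lemma exc_matching:
  assumes "matching (grid n k) M" shows "exc {..<n} (\<Union>M) = 0"
proof -
  have e: "exc {..<n} e = 0 \<and> finite e" if "e \<in> M" for e
  proof -
    have "e \<in> edges (grid n k)" using that assms unfolding matching_def by blast
    then obtain i u v where i: "i \<in> {..<n}" "e = {u, v}" "step i u v" unfolding mem_edges_grid by blast
    have par: "odd (sum v {..<n}) \<longleftrightarrow> even (sum u {..<n})" using step_parity[of "{..<n}" i u v] i by simp
    then have "u \<noteq> v" by blast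
    then show ?thesis using par i(2) by (simp add: exc_def psign_def)
  qed
  have "exc {..<n} (\<Union>M) = (sum \<circ> sum) (\<lambda>u. psign (sum u {..<n})) M"
    unfolding exc_def
  proof (rule sum.Union_disjoint)
    show "\<forall>A\<in>M. finite A" using e by blast
    show "\<forall>A\<in>M. \<forall>B\<in>M. A \<noteq> B \<longrightarrow> A \<inter> B = {}"
      using assms unfolding matching_def by (simp add: disjoint_def)
  qed
  also have "\<dots> = (\<Sum>e\<in>M. exc {..<n} e)" by (simp add: exc_def)
  also have "\<dots> = 0" using e by (intro sum.neutral) blast
  finally show ?thesis .
qed

text \<open>Without its star, \<open>v\<close> is covered by no matching, so an almost perfect one
  would cover exactly the rest. The second hypothesis says that the rest has nonzero excess.\<close>

lemma star_preclusion:
  assumes "v \<in> box {..<n} k" "exc {..<n} (box {..<n} k) - psign (sum v {..<n}) \<noteq> 0"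
  shows "matching_preclusion_set (grid n k) (incident_edges (grid n k) v)"
proof -
  let ?F = "incident_edges (grid n k) v"
  have M: "v \<notin> \<Union>M \<and> exc {..<n} (\<Union>M) = 0" if "matching (delete_edges (grid n k) ?F) M" for M
  proof -
    have sub: "M \<subseteq> edges (grid n k) - ?F" and d: "disjoint M"
      using that unfolding matching_def delete_edges_def by simp_all
    have "v \<notin> \<Union>M" using sub unfolding incident_edges_def by blast
    moreover have "matching (grid n k) M" using sub d unfolding matching_def by blast
    ultimately show ?thesis using exc_matching by blast
  qed
  have V: "verts (delete_edges (grid n k) ?F) = box {..<n} k"
    unfolding delete_edges_def by (simp add: verts_grid)
  show ?thesis unfolding matching_preclusion_set_def
  proof (intro conjI)
    show "?F \<subseteq> edges (grid n k)" unfolding incident_edges_def by blast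
    show "\<not> (\<exists>M. perfect_matching (delete_edges (grid n k) ?F) M)"
      unfolding perfect_matching_def V using M assms(1) by blast
    show "\<not> (\<exists>M. almost_perfect_matching (delete_edges (grid n k) ?F) M)"
    proof
      assume "\<exists>M. almost_perfect_matching (delete_edges (grid n k) ?F) M"
      then obtain M a where m: "matching (delete_edges (grid n k) ?F) M" "\<Union>M = box {..<n} k - {a}"
        unfolding almost_perfect_matching_def V by blast
      then have "a = v" using M[OF m(1)] assms(1) by blast
      then have "exc {..<n} (box {..<n} k - {v}) = 0" using M[OF m(1)] m(2) by simp
      moreover have "exc {..<n} (box {..<n} k - {v}) = exc {..<n} (box {..<n} k) - exc {..<n} {v}"
        using assms(1) by (intro exc_Diff) auto
      ultimately show False using assms(2) by (simp add: exc_def)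
    qed
  qed
qed

text \<open>A matching that avoids \<open>F\<close> and covers all odd vertices is perfect or almost
  perfect, as there are 0 or 1 more even vertices. So Hall's condition fails for some
  \<open>S\<close>, and \<open>X\<close> is \<open>S\<close> together with its remaining
  neighbours.\<close>

lemma preclusion_bad_edges:
  assumes "matching_preclusion_set (grid n k) F"
  obtains X where "X \<subseteq> box {..<n} k" "exc {..<n} X \<ge> 1" "bad_edges {..<n} k X \<subseteq> F"
proof -
  let ?V = "box {..<n} k" and ?I = "{..<n}"
  let ?G = "delete_edges (grid n k) F"
  define A where "A = {u \<in> ?V. even (sum u ?I)}"
  define B where "B = {u \<in> ?V. odd (sum u ?I)}"
  define N where "N b = {a \<in> A. {b, a} \<in> edges (grid n k) - F}" for b
  have fin: "finite A" "finite B" "\<And>b. finite (N b)" by (simp_all add: A_def B_def N_def)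
  have AB: "A \<inter> B = {}" "A \<union> B = ?V" unfolding A_def B_def by blast+
  have "exc ?I ?V = int (card B) - int (card A)"
    unfolding A_def B_def by (rule exc_card) simp
  then have cA: "card A = card B \<or> card A = card B + 1"
    unfolding exc_box[OF finite_lessThan] by (auto split: if_splits)
  have V: "verts ?G = ?V" "edges ?G = edges (grid n k) - F"
    unfolding delete_edges_def by (simp_all add: verts_grid)
  have "\<exists>S\<subseteq>B. card (\<Union>(N ` S)) < card S"
  proof (rule ccontr)
    assume "\<not> ?thesis"
    then have "\<exists>f. inj_on f B \<and> (\<forall>b\<in>B. f b \<in> N b)"
      by (intro hall fin) (meson not_less)
    then obtain f where f: "inj_on f B" "\<And>b. b \<in> B \<Longrightarrow> f b \<in> N b" by blast
    let ?M = "(\<lambda>b. {b, f b}) ` B"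
    have fA: "f b \<in> A" if "b \<in> B" for b using f(2)[OF that] unfolding N_def by blast
    have "matching ?G ?M" unfolding matching_def V
    proof
      show "?M \<subseteq> edges (grid n k) - F" using f(2) unfolding N_def by blast
      show "disjoint ?M" unfolding disjoint_def
      proof (intro ballI impI)
        fix e e' assume "e \<in> ?M" "e' \<in> ?M" "e \<noteq> e'"
        then obtain b b' where b: "e = {b, f b}" "e' = {b', f b'}" "b \<in> B" "b' \<in> B" "b \<noteq> b'" by blast
        then have "f b \<noteq> f b'" using f(1) by (simp add: inj_on_eq_iff)
        then show "e \<inter> e' = {}" using b fA[OF b(3)] fA[OF b(4)] AB(1) by blast
      qed
    qed
    have U: "\<Union>?M = B \<union> f ` B" by blast
    have card: "card (f ` B) = card B" using f(1) by (rule card_image)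
    have sub: "f ` B \<subseteq> A" using fA by blast
    show False using cA
    proof
      assume "card A = card B"
      then have "f ` B = A" using card_subset_eq[OF fin(1) sub] card by simp
      then have "\<Union>?M = ?V" using U AB(2) by blast
      then have "perfect_matching ?G ?M" using \<open>matching ?G ?M\<close> unfolding perfect_matching_def V by blast
      then show False using assms unfolding matching_preclusion_set_def by blast
    next
      assume "card A = card B + 1"
      then have "card (A - f ` B) = 1" using card_Diff_subset[OF finite_subset[OF sub fin(1)] sub] card by simp
      then obtain a where a: "A - f ` B = {a}" by (rule card_1_singletonE)
      then have "A = insert a (f ` B)" "a \<in> A" "a \<notin> f ` B" using sub by blast+
      moreover have "a \<notin> B" using \<open>a \<in> A\<close> AB(1) by blast
      ultimately have "\<Union>?M = ?V - {a}" "a \<in> ?V" unfolding U AB(2)[symmetric] by blast+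
      then have "almost_perfect_matching ?G ?M"
        using \<open>matching ?G ?M\<close> unfolding almost_perfect_matching_def V by blast
      then show False using assms unfolding matching_preclusion_set_def by blast
    qed
  qed
  then obtain S where S: "S \<subseteq> B" "card (\<Union>(N ` S)) < card S" by blast
  let ?X = "S \<union> \<Union>(N ` S)"
  have NA: "\<Union>(N ` S) \<subseteq> A" unfolding N_def by blast
  have XV: "?X \<subseteq> ?V" using S(1) NA AB(2) by blast
  have odd: "{u \<in> ?X. odd (sum u ?I)} = S" and even: "{u \<in> ?X. even (sum u ?I)} = \<Union>(N ` S)"
    using S(1) NA unfolding A_def B_def by blast+
  have "exc ?I ?X = int (card S) - int (card (\<Union>(N ` S)))"
    using exc_card[OF finite_subset[OF XV], of ?I] unfolding odd even by simp
  then have "exc ?I ?X \<ge> 1" using S(2) by simp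
  moreover have "bad_edges ?I k ?X \<subseteq> F"
  proof
    fix e assume "e \<in> bad_edges ?I k ?X"
    then obtain i u v where i: "i \<in> ?I" "e = {u, v}" "(u, v) \<in> bad ?I k ?X i" unfolding mem_bad_edges by blast
    then have uv: "u \<in> ?V" "v \<in> ?V" "u \<in> ?X" "v \<notin> ?X" "step i u v" "odd (sum u ?I)" unfolding mem_bad by blast+
    then have "u \<in> S" using odd by blast
    moreover have "{u, v} \<in> edges (grid n k)" using i uv unfolding mem_edges_grid by blast
    moreover have "v \<in> A" using uv step_parity[of ?I i u v] i(1) unfolding A_def by blast
    ultimately show "e \<in> F" using uv(4) i(2) unfolding N_def by blast
  qed
  ultimately show ?thesis using that XV by blast
qed

lemma card_le_of_bad_edges:
  assumes "matching_preclusion_set (grid n k) F" "bad_edges {..<n} k X \<subseteq> F"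
  shows "(\<Sum>i<n. card (bad {..<n} k X i)) \<le> card F"
proof -
  have "finite F"
    using assms(1) finite_edges_grid unfolding matching_preclusion_set_def by (metis finite_subset)
  then have "card (bad_edges {..<n} k X) \<le> card F" using assms(2) by (rule card_mono)
  then show ?thesis by (simp add: card_bad_edges)
qed

section \<open>Matching preclusion number and optimal sets\<close>

lemma mp_eqI:
  assumes "matching_preclusion_set G F" "card F = m"
    and "\<And>F'. matching_preclusion_set G F' \<Longrightarrow> m \<le> card F'"
  shows "mp G = m"
  unfolding mp_def by (rule Least_equality) (use assms in auto)

lemma optimal_iff:
  assumes "matching_preclusion_set G F0" "card F0 = m"
    and "\<And>F'. matching_preclusion_set G F' \<Longrightarrow> m \<le> card F'"
  shows "optimal_matching_preclusion_set G F \<longleftrightarrow> matching_preclusion_set G F \<and> card F = m"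
  unfolding optimal_matching_preclusion_set_def using assms by (metis le_antisym)

theorem theorem1p2:
  fixes n :: nat and k :: "nat \<Rightarrow> nat"
  assumes "n \<ge> 1" and "\<And>i. i < n \<Longrightarrow> k i \<ge> 2"
  shows
    "(even (card (verts (grid n k))) \<longrightarrow>
        mp (grid n k) = n \<and> (n \<ge> 3 \<longrightarrow> super_matched (grid n k))) \<and>
     (odd (card (verts (grid n k))) \<longrightarrow>
        mp (grid n k) = n + 1 \<and>
        (n \<ge> 2 \<longrightarrow>
          (\<forall>F \<subseteq> edges (grid n k).
             optimal_matching_preclusion_set (grid n k) F \<longleftrightarrow>
             (\<exists>u \<in> verts (grid n k).
                F = incident_edges (grid n k) u \<and>
                degree (grid n k) u = n + 1 \<and>
                odd (\<Sum>i<n. u i)))))"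
proof (intro conjI impI)
  let ?I = "{..<n}" and ?V = "box {..<n} k" and ?G = "grid n k"
  have fin: "finite ?I" and cI: "card ?I = n" by simp_all
  have k2: "\<And>i. i \<in> ?I \<Longrightarrow> k i \<ge> 2" using assms(2) by simp
  have card_V: "card (verts ?G) = (\<Prod>i<n. k i)"
    unfolding verts_grid box_def by (simp add: card_PiE)
  note excV = exc_box[OF fin, of k]
  {
    assume even: "even (card (verts ?G))"
    then obtain i where i: "i \<in> ?I" "even (k i)" unfolding card_V by (auto simp: even_prod_iff)
    then have ex: "\<exists>i\<in>?I. even (k i)" by blast
    then have exc0: "exc ?I ?V = 0" unfolding excV by auto
    \<comment> \<open>Removing any vertex from a box of excess 0 leaves excess 1 or -1.\<close>
    have star: "matching_preclusion_set ?G (incident_edges ?G v)" if "v \<in> ?V" for v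
      by (rule star_preclusion[OF that]) (simp add: exc0 psign_def)
    have lower: "n \<le> card F" if F: "matching_preclusion_set ?G F" for F
    proof -
      obtain X where X: "X \<subseteq> ?V" "exc ?I X \<ge> 1" "bad_edges ?I k X \<subseteq> F"
        using preclusion_bad_edges[OF F] .
      show ?thesis using even_box_bad[OF fin k2 ex X(1,2)] card_le_of_bad_edges[OF F X(3)] cI by linarith
    qed
    \<comment> \<open>The corner at the origin has at most one neighbour in each direction, so its
      star attains the lower bound.\<close>
    define a where "a = (\<lambda>j. if j < n then 0 else undefined :: nat)"
    have a: "a \<in> ?V" using k2 by (force simp: a_def box_def PiE_iff extensional_def)
    have "sum a ?I = 0" by (simp add: a_def)
    then have "incident_edges ?G a = bad_edges ?I k (?V - {a})" using incident_even[OF a] by simp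
    then have "card (incident_edges ?G a) = (\<Sum>i<n. card (bad ?I k (?V - {a}) i))"
      by (simp add: card_bad_edges)
    also have "\<dots> \<le> (\<Sum>i<n. 1)"
    proof (rule sum_mono)
      fix i assume i: "i \<in> ?I"
      have "bad ?I k (?V - {a}) i \<subseteq> {(a(i := 1), a)}"
      proof (rule subrelI)
        fix u v assume "(u, v) \<in> bad ?I k (?V - {a}) i"
        then have v: "v = a" and st: "step i u v" unfolding mem_bad by blast+
        have "a i = 0" using i by (simp add: a_def)
        then have "u i = 1" using st unfolding v step_def by auto
        then have "u = a(i := 1)" using step_eq[OF step_sym[OF st]] unfolding v by simp
        then show "(u, v) \<in> {(a(i := 1), a)}" using v by simp
      qed
      then show "card (bad ?I k (?V - {a}) i) \<le> 1" using card_mono[of "{(a(i := 1), a)}"] by simp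
    qed
    finally have "card (incident_edges ?G a) \<le> n" by simp
    then have card_a: "card (incident_edges ?G a) = n" using lower[OF star[OF a]] by simp
    show "mp ?G = n" by (rule mp_eqI[OF star[OF a] card_a lower])
    assume n3: "n \<ge> 3"
    show "super_matched ?G" unfolding super_matched_def verts_grid
    proof (intro conjI allI impI)
      show "even (card ?V)" using even unfolding verts_grid .
      fix F assume "optimal_matching_preclusion_set ?G F"
      then have F: "matching_preclusion_set ?G F" "card F = n"
        using optimal_iff[OF star[OF a] card_a lower] by blast+
      obtain X where X: "X \<subseteq> ?V" "exc ?I X \<ge> 1" "bad_edges ?I k X \<subseteq> F"
        using preclusion_bad_edges[OF F(1)] .
      have le: "(\<Sum>j\<in>?I. card (bad ?I k X j)) \<le> card ?I" using card_le_of_bad_edges[OF F(1) X(3)] F(2) by simp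
      \<comment> \<open>\<open>F\<close> contains the bad edges of \<open>X\<close> and is no
        larger, hence equals them.\<close>
      have "card F \<le> card (bad_edges ?I k X)"
        using even_box_bad[OF fin k2 ex X(1,2)] F(2) by (simp add: card_bad_edges)
      moreover have "finite F"
        using F(1) finite_edges_grid unfolding matching_preclusion_set_def by (metis finite_subset)
      ultimately have eq: "F = bad_edges ?I k X" using card_seteq[OF _ X(3)] by blast
      have "(\<exists>u. X = {u} \<and> odd (sum u ?I)) \<or> (\<exists>a\<in>?V. X = ?V - {a} \<and> even (sum a ?I))"
        by (rule even_box_bad_eq[OF fin k2 i X(1,2) le]) (use n3 in simp_all)
      then show "\<exists>v\<in>?V. F = incident_edges ?G v"
      proof (elim disjE exE bexE conjE)
        fix u assume "X = {u}" "odd (sum u ?I)"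
        then show ?thesis using eq X(1) incident_odd[of u n k] by blast
      next
        fix b assume "b \<in> ?V" "X = ?V - {b}" "even (sum b ?I)"
        then show ?thesis using eq incident_even[of b n k] by blast
      qed
    qed
  }
  {
    assume odd: "odd (card (verts ?G))"
    then have ko: "\<And>i. i \<in> ?I \<Longrightarrow> odd (k i)" unfolding card_V by (auto simp: even_prod_iff)
    then have exc1: "exc ?I ?V = - 1" unfolding excV by simp
    \<comment> \<open>Removing an odd vertex from a box of excess -1 leaves -2; removing an even one
      would leave 0.\<close>
    have star: "matching_preclusion_set ?G (incident_edges ?G v)" if "v \<in> ?V" "odd (sum v ?I)" for v
      by (rule star_preclusion[OF that(1)]) (simp add: exc1 psign_def that(2))
    have lower: "n + 1 \<le> card F" if F: "matching_preclusion_set ?G F" for F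
    proof -
      obtain X where X: "X \<subseteq> ?V" "exc ?I X \<ge> 1" "bad_edges ?I k X \<subseteq> F"
        using preclusion_bad_edges[OF F] .
      have "card ?I + 1 \<le> (\<Sum>j\<in>?I. card (bad ?I k X j))"
        using odd_box_bad[OF fin k2 ko X(1)] X(2) by blast
      then show ?thesis using card_le_of_bad_edges[OF F X(3)] cI by linarith
    qed
    \<comment> \<open>The vertex \<open>(1, 0, ..., 0)\<close> is odd and has at most two neighbours
      in direction 0 and one in every other direction.\<close>
    define a where "a = (\<lambda>j. if j < n then of_bool (j = 0) else undefined :: nat)"
    have a: "a \<in> ?V" using assms(2) by (force simp: a_def box_def PiE_iff extensional_def)
    have "sum a ?I = (\<Sum>j<n. of_bool (j = 0))" by (simp add: a_def)
    also have "\<dots> = 1" using assms(1) by (simp add: of_bool_def sum.delta)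
    finally have odd_a: "odd (sum a ?I)" by simp
    have "card (incident_edges ?G a) = (\<Sum>i<n. card (bad ?I k {a} i))"
      unfolding incident_odd[OF a odd_a] by (simp add: card_bad_edges)
    also have "\<dots> \<le> (\<Sum>i<n. 1 + of_bool (i = 0))"
    proof (rule sum_mono)
      fix i assume i: "i \<in> ?I"
      have sub: "bad ?I k {a} i \<subseteq> insert (a, a(i := a i + 1)) (if i = 0 then {(a, a(i := 0))} else {})"
      proof (rule subrelI)
        fix u v assume "(u, v) \<in> bad ?I k {a} i"
        then have u: "u = a" and st: "step i u v" unfolding mem_bad by blast+
        have "a i = of_bool (i = 0)" using i by (simp add: a_def)
        then have "v i = a i + 1 \<or> i = 0 \<and> v i = 0" using st unfolding u step_def by (auto split: if_splits)
        then have "v = a(i := a i + 1) \<or> i = 0 \<and> v = a(i := 0)" using step_eq[OF st] unfolding u by metis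
        then show "(u, v) \<in> insert (a, a(i := a i + 1)) (if i = 0 then {(a, a(i := 0))} else {})"
          using u by auto
      qed
      have "card (bad ?I k {a} i) \<le> card (insert (a, a(i := a i + 1)) (if i = 0 then {(a, a(i := 0))} else {}))"
        by (rule card_mono[OF _ sub]) simp
      also have "\<dots> \<le> Suc (card (if i = 0 then {(a, a(i := 0))} else {}))" by (rule card_insert_le_m1) simp_all
      also have "\<dots> = 1 + of_bool (i = 0)" by simp
      finally show "card (bad ?I k {a} i) \<le> 1 + of_bool (i = 0)" .
    qed
    also have "\<dots> = n + 1" unfolding sum.distrib using assms(1) by (simp add: of_bool_def sum.delta)
    finally have card_a: "card (incident_edges ?G a) = n + 1" using lower[OF star[OF a odd_a]] by simp
    show "mp ?G = n + 1" by (rule mp_eqI[OF star[OF a odd_a] card_a lower])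
    have opt: "optimal_matching_preclusion_set ?G F \<longleftrightarrow> matching_preclusion_set ?G F \<and> card F = n + 1" for F
      by (rule optimal_iff[OF star[OF a odd_a] card_a lower])
    assume n2: "n \<ge> 2"
    show "\<forall>F \<subseteq> edges ?G. optimal_matching_preclusion_set ?G F \<longleftrightarrow>
       (\<exists>u\<in>verts ?G. F = incident_edges ?G u \<and> degree ?G u = n + 1 \<and> odd (\<Sum>i<n. u i))"
      unfolding verts_grid opt degree_def
    proof (intro allI impI iffI)
      fix F assume F: "matching_preclusion_set ?G F \<and> card F = n + 1"
      obtain X where X: "X \<subseteq> ?V" "exc ?I X \<ge> 1" "bad_edges ?I k X \<subseteq> F"
        using preclusion_bad_edges[OF conjunct1[OF F]] .
      have le: "(\<Sum>j\<in>?I. card (bad ?I k X j)) \<le> card ?I + 1"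
        using card_le_of_bad_edges[OF conjunct1[OF F] X(3)] F by simp
      obtain u where u: "X = {u}" "odd (sum u ?I)"
        using odd_box_bad_eq[OF fin k2 ko X(1) _ X(2) le] n2 by auto
      have "card ?I + 1 \<le> (\<Sum>j\<in>?I. card (bad ?I k X j))"
        using odd_box_bad[OF fin k2 ko X(1)] X(2) by blast
      then have "card F \<le> card (bad_edges ?I k X)" using F by (simp add: card_bad_edges)
      moreover have "finite F"
        using F finite_edges_grid unfolding matching_preclusion_set_def by (metis finite_subset)
      ultimately have "F = bad_edges ?I k X" using card_seteq[OF _ X(3)] by blast
      moreover have "u \<in> ?V" using u(1) X(1) by blast
      ultimately show "\<exists>u\<in>?V. F = incident_edges ?G u \<and> card (incident_edges ?G u) = n + 1 \<and> odd (\<Sum>i<n. u i)"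
        using incident_odd[of u n k] u F by metis
    next
      fix F assume "\<exists>u\<in>?V. F = incident_edges ?G u \<and> card (incident_edges ?G u) = n + 1 \<and> odd (\<Sum>i<n. u i)"
      then show "matching_preclusion_set ?G F \<and> card F = n + 1" using star by blast
    qed
  }
qed

end
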